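(* Let $\mathbb{F}$ be a field and let $k\ge 4$ be an integer. The persistence module $PH_1((\mathsf{Star}_k)^2_{-,-};\mathbb{F})$ is interval decomposable, i.e. isomorphic to a direct sum of interval modules.
   Context: Metric graph and configuration spaces: the star graph $S_k$ is the geometric realization of the tree with one central vertex and $k$ edges $e_1,\dots,e_k$, each joining the central vertex to a leaf. For $L>0$ let $\delta_L$ be the path metric on $S_k$ in which $e_1$ has length $L=L_{e_1}$ and all other edges have length $1$ (each edge is a fixed copy of $[0,1]$, rescaled linearly to its length). For $r>0$, $(\mathsf{Star}_k)^2_{r,L}=\{(x,y)\in S_k\times S_k\mid \delta_L(x,y)\ge r\}$. Poset and persistence module: let $P=(\mathbb{R}_{>0},\le)^{\mathrm{op}}\times(\mathbb{R}_{>0},\le)$, i.e. pairs $(r,L)$ with $(r,L)\le (r',L')$ iff $r'\le r$ and $L\le L'$; then $(\mathsf{Star}_k)^2_{r,L}\subseteq (\mathsf{Star}_k)^2_{r',L'}$. A persistence module over $P$ is a functor $P\to \mathrm{Vect}_{\mathbb{F}}$. $PH_i((\mathsf{Star}_k)^2_{-,-};\mathbb{F})$ is $(r,L)\mapsto H_i((\mathsf{Star}_k)^2_{r,L};\mathbb{F})$ with maps induced by inclusions. Interval modules: $I\subseteq P$ is an interval if it is connected (as a poset) and convex ($a\le b\le c$, $a,c\in I$ imply $b\in I$); the interval module supported on $I$ is $\mathbb{F}$ on $I$ and $0$ elsewhere, with identity maps within $I$ and zero maps otherwise. *)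

theory Defs
  imports "HOL-Homology.Homology" "HOL-Algebra.Algebraic_Closure_Type"
begin

section \<open>Persistence modules over a poset\<close>

text \<open>
  A poset is given by a carrier set \<open>P\<close> and a relation \<open>ple\<close>. Vector spaces over a field
  \<open>'f\<close> are modules (in the sense of HOL-Algebra) over \<open>ring_of_type_algebra\<close>, the field
  \<open>'f\<close> seen as a ring record; the fields \<open>monoid.mult\<close> and \<open>one\<close> of the record type
  \<open>('f, 'v) module\<close> play no role and are left unspecified.
\<close>

abbreviation vector_space_rec :: "('f::field, 'v) module \<Rightarrow> bool" where
  "vector_space_rec V \<equiv> module (ring_of_type_algebra :: 'f ring) V"

definition linear_map :: "('f::field, 'v) module \<Rightarrow> ('f, 'w) module \<Rightarrow> ('v \<Rightarrow> 'w) \<Rightarrow> bool" where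
  "linear_map V W g \<longleftrightarrow>
     g \<in> carrier V \<rightarrow> carrier W \<and>
     (\<forall>x\<in>carrier V. \<forall>y\<in>carrier V. g (x \<oplus>\<^bsub>V\<^esub> y) = g x \<oplus>\<^bsub>W\<^esub> g y) \<and>
     (\<forall>c. \<forall>x\<in>carrier V. g (c \<odot>\<^bsub>V\<^esub> x) = c \<odot>\<^bsub>W\<^esub> g x)"

record ('p, 'f, 'v) pmod =
  pspace :: "'p \<Rightarrow> ('f, 'v) module"
  pmap :: "'p \<Rightarrow> 'p \<Rightarrow> 'v \<Rightarrow> 'v"

definition persistence_module ::
    "'p set \<Rightarrow> ('p \<Rightarrow> 'p \<Rightarrow> bool) \<Rightarrow> ('p, 'f::field, 'v) pmod \<Rightarrow> bool" where
  "persistence_module P ple M \<longleftrightarrow>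
     (\<forall>p\<in>P. vector_space_rec (pspace M p)) \<and>
     (\<forall>p\<in>P. \<forall>q\<in>P. ple p q \<longrightarrow> linear_map (pspace M p) (pspace M q) (pmap M p q)) \<and>
     (\<forall>p\<in>P. \<forall>x\<in>carrier (pspace M p). pmap M p p x = x) \<and>
     (\<forall>p\<in>P. \<forall>q\<in>P. \<forall>s\<in>P. ple p q \<longrightarrow> ple q s \<longrightarrow>
        (\<forall>x\<in>carrier (pspace M p). pmap M q s (pmap M p q x) = pmap M p s x))"

definition pmod_isomorphic ::
    "'p set \<Rightarrow> ('p \<Rightarrow> 'p \<Rightarrow> bool) \<Rightarrow> ('p, 'f::field, 'v) pmod \<Rightarrow> ('p, 'f, 'w) pmod \<Rightarrow> bool" where
  "pmod_isomorphic P ple M N \<longleftrightarrow>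
     (\<exists>h. (\<forall>p\<in>P. linear_map (pspace M p) (pspace N p) (h p) \<and>
                 bij_betw (h p) (carrier (pspace M p)) (carrier (pspace N p))) \<and>
          (\<forall>p\<in>P. \<forall>q\<in>P. ple p q \<longrightarrow>
             (\<forall>x\<in>carrier (pspace M p). h q (pmap M p q x) = pmap N p q (h p x))))"

definition poset_connected :: "('p \<Rightarrow> 'p \<Rightarrow> bool) \<Rightarrow> 'p set \<Rightarrow> bool" where
  "poset_connected ple I \<longleftrightarrow>
     I \<noteq> {} \<and> (\<forall>a\<in>I. \<forall>b\<in>I. (a, b) \<in> {(x, y). x \<in> I \<and> y \<in> I \<and> (ple x y \<or> ple y x)}\<^sup>*)"

definition poset_convex :: "'p set \<Rightarrow> ('p \<Rightarrow> 'p \<Rightarrow> bool) \<Rightarrow> 'p set \<Rightarrow> bool" where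
  "poset_convex P ple I \<longleftrightarrow> (\<forall>a\<in>I. \<forall>c\<in>I. \<forall>b\<in>P. ple a b \<longrightarrow> ple b c \<longrightarrow> b \<in> I)"

definition poset_interval :: "'p set \<Rightarrow> ('p \<Rightarrow> 'p \<Rightarrow> bool) \<Rightarrow> 'p set \<Rightarrow> bool" where
  "poset_interval P ple I \<longleftrightarrow> I \<subseteq> P \<and> poset_connected ple I \<and> poset_convex P ple I"

definition interval_module :: "'p set \<Rightarrow> ('p, 'f::field, 'f) pmod" where
  "interval_module I =
     \<lparr>pspace = (\<lambda>p. \<lparr>carrier = (if p \<in> I then UNIV else {0}), monoid.mult = undefined, one = undefined,
                     zero = 0, add = (+), module.smult = (*)\<rparr>),
      pmap = (\<lambda>p q x. if p \<in> I \<and> q \<in> I then x else 0)\<rparr>"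

definition pmod_direct_sum ::
    "'j set \<Rightarrow> ('j \<Rightarrow> ('p, 'f::field, 'v) pmod) \<Rightarrow> ('p, 'f, 'j \<Rightarrow> 'v) pmod" where
  "pmod_direct_sum J M =
     \<lparr>pspace = (\<lambda>p.
        \<lparr>carrier = {x \<in> (\<Pi>\<^sub>E j\<in>J. carrier (pspace (M j) p)).
                      finite {j \<in> J. x j \<noteq> \<zero>\<^bsub>pspace (M j) p\<^esub>}},
         monoid.mult = undefined, one = undefined,
         zero = (\<lambda>j\<in>J. \<zero>\<^bsub>pspace (M j) p\<^esub>),
         add = (\<lambda>x y. \<lambda>j\<in>J. x j \<oplus>\<^bsub>pspace (M j) p\<^esub> y j),
         module.smult = (\<lambda>c x. \<lambda>j\<in>J. c \<odot>\<^bsub>pspace (M j) p\<^esub> x j)\<rparr>),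
      pmap = (\<lambda>p q x. \<lambda>j\<in>J. pmap (M j) p q (x j))\<rparr>"

text \<open>
  The index set \<open>J\<close> of the direct sum is drawn from the type \<open>'p set \<times> 'v\<close>. This is no
  restriction: each summand isomorphic to the interval module on a given nonempty \<open>I\<close>
  contributes, at any \<open>p \<in> I\<close>, a member of a linearly independent family in \<open>pspace M p\<close>, so
  any family of summands can be indexed by pairs of an interval and a vector.
\<close>

definition interval_decomposable ::
    "'p set \<Rightarrow> ('p \<Rightarrow> 'p \<Rightarrow> bool) \<Rightarrow> ('p, 'f::field, 'v) pmod \<Rightarrow> bool" where
  "interval_decomposable P ple M \<longleftrightarrow>
     (\<exists>(J :: ('p set \<times> 'v) set) I.
        (\<forall>j\<in>J. poset_interval P ple (I j)) \<and>
        pmod_isomorphic P ple M (pmod_direct_sum J (\<lambda>j. interval_module (I j))))"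

section \<open>Singular homology with coefficients in a field\<close>

text \<open>The library's singular chain complex, with coefficients in \<open>'f\<close> instead of \<open>int\<close>.\<close>

type_synonym ('a, 'f) fchain = "((nat \<Rightarrow> real) \<Rightarrow> 'a) \<Rightarrow>\<^sub>0 'f"

definition fsmult :: "'f::field \<Rightarrow> ('b \<Rightarrow>\<^sub>0 'f) \<Rightarrow> ('b \<Rightarrow>\<^sub>0 'f)" where
  "fsmult c x = Poly_Mapping.map ((*) c) x"

definition fextend :: "('b \<Rightarrow> ('d \<Rightarrow>\<^sub>0 'f)) \<Rightarrow> ('b \<Rightarrow>\<^sub>0 'f) \<Rightarrow> ('d \<Rightarrow>\<^sub>0 'f::field)" where
  "fextend b x = (\<Sum>s\<in>Poly_Mapping.keys x. fsmult (Poly_Mapping.lookup x s) (b s))"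

definition fchains :: "nat \<Rightarrow> 'a topology \<Rightarrow> ('a, 'f::field) fchain set" where
  "fchains p U = {c. Poly_Mapping.keys c \<subseteq> singular_simplex_set p U}"

definition fboundary :: "nat \<Rightarrow> ('a, 'f::field) fchain \<Rightarrow> ('a, 'f) fchain" where
  "fboundary p c =
     (if p = 0 then 0
      else fextend (\<lambda>s. \<Sum>k\<le>p. Poly_Mapping.single (singular_face p k s) ((-1) ^ k)) c)"

definition fcycles :: "nat \<Rightarrow> 'a topology \<Rightarrow> ('a, 'f::field) fchain set" where
  "fcycles p U = {c \<in> fchains p U. fboundary p c = 0}"

definition fboundaries :: "nat \<Rightarrow> 'a topology \<Rightarrow> ('a, 'f::field) fchain set" where
  "fboundaries p U = fboundary (Suc p) ` fchains (Suc p) U"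

definition fclass :: "nat \<Rightarrow> 'a topology \<Rightarrow> ('a, 'f::field) fchain \<Rightarrow> ('a, 'f) fchain set" where
  "fclass p U z = {z + b | b. b \<in> fboundaries p U}"

definition fhomology ::
    "nat \<Rightarrow> 'a topology \<Rightarrow> ('f::field, ('a, 'f) fchain set) module" where
  "fhomology p U =
     \<lparr>carrier = fclass p U ` fcycles p U, monoid.mult = undefined, one = undefined,
      zero = fboundaries p U,
      add = (\<lambda>A B. {a + b | a b. a \<in> A \<and> b \<in> B}),
      module.smult = (\<lambda>c A. {fsmult c a + b | a b. a \<in> A \<and> b \<in> fboundaries p U})\<rparr>"

definition fchain_map :: "nat \<Rightarrow> ('a \<Rightarrow> 'b) \<Rightarrow> ('a, 'f::field) fchain \<Rightarrow> ('b, 'f) fchain" where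
  "fchain_map p g c = fextend (\<lambda>s. Poly_Mapping.single (simplex_map p g s) 1) c"

text \<open>The map into \<open>H\<^sub>p(Y)\<close> induced by a continuous map \<open>g\<close>, sending the class of \<open>z\<close> to the
  class of \<open>g\<^sub># z\<close>.\<close>

definition fhomology_map ::
    "nat \<Rightarrow> 'b topology \<Rightarrow> ('a \<Rightarrow> 'b) \<Rightarrow> ('a, 'f::field) fchain set \<Rightarrow> ('b, 'f) fchain set" where
  "fhomology_map p Y g A = {fchain_map p g a + b | a b. a \<in> A \<and> b \<in> fboundaries p Y}"

section \<open>Two-point configuration spaces of star graphs\<close>

text \<open>
  The point at parameter \<open>t \<in> [0,1]\<close> on the edge \<open>e\<^sub>i\<close> is encoded as \<open>t\<close> times the \<open>i\<close>-th unit
  vector, so that parameter \<open>0\<close> on every edge is the central vertex (the origin). The topology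
  of the graph is the one induced by the product topology on \<open>nat \<Rightarrow> real\<close>.
\<close>

definition star_point :: "nat \<Rightarrow> real \<Rightarrow> nat \<Rightarrow> real" where
  "star_point i t = (\<lambda>j. if j = i then t else 0)"

definition star_graph :: "nat \<Rightarrow> (nat \<Rightarrow> real) set" where
  "star_graph k = {star_point i t | i t. i \<in> {1..k} \<and> t \<in> {0..1}}"

definition edge_length :: "real \<Rightarrow> nat \<Rightarrow> real" where
  "edge_length L i = (if i = 1 then L else 1)"

text \<open>\<open>star_path k L x y l\<close>: there is a piecewise linear path in the graph from \<open>x\<close> to \<open>y\<close> of
  length \<open>l\<close>, each linear piece running inside a single edge.\<close>

inductive star_path :: "nat \<Rightarrow> real \<Rightarrow> (nat \<Rightarrow> real) \<Rightarrow> (nat \<Rightarrow> real) \<Rightarrow> real \<Rightarrow> bool"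
  for k :: nat and L :: real and x :: "nat \<Rightarrow> real" where
  refl: "x \<in> star_graph k \<Longrightarrow> star_path k L x x 0"
| step: "\<lbrakk>star_path k L x (star_point i s) l; i \<in> {1..k}; s \<in> {0..1}; t \<in> {0..1}\<rbrakk>
    \<Longrightarrow> star_path k L x (star_point i t) (l + edge_length L i * \<bar>s - t\<bar>)"

definition star_dist :: "nat \<Rightarrow> real \<Rightarrow> (nat \<Rightarrow> real) \<Rightarrow> (nat \<Rightarrow> real) \<Rightarrow> real" where
  "star_dist k L x y = Inf {l. star_path k L x y l}"

definition star_conf :: "nat \<Rightarrow> real \<Rightarrow> real \<Rightarrow> ((nat \<Rightarrow> real) \<times> (nat \<Rightarrow> real)) set" where
  "star_conf k r L = {(x, y). x \<in> star_graph k \<and> y \<in> star_graph k \<and> star_dist k L x y \<ge> r}"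

definition scale_poset :: "(real \<times> real) set" where
  "scale_poset = {0<..} \<times> {0<..}"

definition scale_le :: "real \<times> real \<Rightarrow> real \<times> real \<Rightarrow> bool" where
  "scale_le = (\<lambda>(r, L) (r', L'). r' \<le> r \<and> L \<le> L')"

definition star_PH ::
    "nat \<Rightarrow> nat \<Rightarrow>
     (real \<times> real, 'f::field, ((nat \<Rightarrow> real) \<times> (nat \<Rightarrow> real), 'f) fchain set) pmod" where
  "star_PH k i =
     \<lparr>pspace = (\<lambda>(r, L). fhomology i (top_of_set (star_conf k r L))),
      pmap = (\<lambda>(r, L) (r', L'). fhomology_map i (top_of_set (star_conf k r' L')) (\<lambda>z. z))\<rparr>"

section \<open>Basic facts\<close>

lemma star_point_in: "i \<in> {1..k} \<Longrightarrow> t \<in> {0..1} \<Longrightarrow> star_point i t \<in> star_graph k"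
  by (auto simp: star_graph_def)

lemma star_path_lower:
  assumes "star_path k L x y l" "L > 0"
  shows "(\<Sum>i=1..k. edge_length L i * \<bar>x i - y i\<bar>) \<le> l"
  using assms
proof (induction rule: star_path.induct)
  case refl
  then show ?case by simp
next
  case (step i s l t)
  let ?d = "\<lambda>u v. \<Sum>j=1..k. edge_length L j * \<bar>u j - v j\<bar>"
  have "?d x (star_point i t) \<le> ?d x (star_point i s) + ?d (star_point i s) (star_point i t)"
    unfolding sum.distrib[symmetric]
  proof (rule sum_mono)
    fix j
    have "0 \<le> edge_length L j" using step.prems by (simp add: edge_length_def)
    then show "edge_length L j * \<bar>x j - star_point i t j\<bar>
        \<le> edge_length L j * \<bar>x j - star_point i s j\<bar>
           + edge_length L j * \<bar>star_point i s j - star_point i t j\<bar>"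
      unfolding distrib_left[symmetric] by (intro mult_left_mono) auto
  qed
  also have "?d (star_point i s) (star_point i t)
      = (\<Sum>j=1..k. if j = i then edge_length L i * \<bar>s - t\<bar> else 0)"
    by (rule sum.cong) (auto simp: star_point_def)
  also have "\<dots> = edge_length L i * \<bar>s - t\<bar>"
    using step.hyps by simp
  finally show ?case using step by simp
qed

lemma star_path_exists:
  assumes "x \<in> star_graph k" "y \<in> star_graph k"
  shows "star_path k L x y (\<Sum>i=1..k. edge_length L i * \<bar>x i - y i\<bar>)"
proof -
  obtain i s where x: "x = star_point i s" "i \<in> {1..k}" "s \<in> {0..1}"
    using assms(1) by (auto simp: star_graph_def)
  obtain j t where y: "y = star_point j t" "j \<in> {1..k}" "t \<in> {0..1}"
    using assms(2) by (auto simp: star_graph_def)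
  note 0 = star_path.refl[OF assms(1), of L]
  show ?thesis
  proof (cases "i = j")
    case True
    have "(\<Sum>m=1..k. edge_length L m * \<bar>x m - y m\<bar>)
        = (\<Sum>m=1..k. if m = i then edge_length L i * \<bar>s - t\<bar> else 0)"
      by (rule sum.cong) (auto simp: x(1) y(1) True star_point_def)
    also have "\<dots> = 0 + edge_length L i * \<bar>s - t\<bar>" using x by simp
    finally show ?thesis
      using star_path.step[OF 0[unfolded x(1)] x(2,3) y(3)] by (simp add: x(1) y(1) True)
  next
    case False
    have "(\<Sum>m=1..k. edge_length L m * \<bar>x m - y m\<bar>)
        = (\<Sum>m=1..k. (if m = i then edge_length L i * \<bar>s - 0\<bar> else 0)
                     + (if m = j then edge_length L j * \<bar>0 - t\<bar> else 0))"
      by (rule sum.cong) (use False in \<open>auto simp: x(1) y(1) star_point_def\<close>)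
    also have "\<dots> = 0 + edge_length L i * \<bar>s - 0\<bar> + edge_length L j * \<bar>0 - t\<bar>"
      using x y by (simp add: sum.distrib)
    finally have eq: "(\<Sum>m=1..k. edge_length L m * \<bar>x m - y m\<bar>)
        = 0 + edge_length L i * \<bar>s - 0\<bar> + edge_length L j * \<bar>0 - t\<bar>" .
    have "star_path k L x (star_point i 0) (0 + edge_length L i * \<bar>s - 0\<bar>)"
      using star_path.step[OF 0[unfolded x(1)] x(2,3), of 0] by (simp add: x(1))
    moreover have "star_point i 0 = star_point j 0"
      by (auto simp: star_point_def)
    ultimately have "star_path k L x (star_point j 0) (0 + edge_length L i * \<bar>s - 0\<bar>)"
      by simp
    from star_path.step[OF this y(2) _ y(3)] show ?thesis
      unfolding eq by (simp add: y(1))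
  qed
qed

lemma star_dist_eq:
  assumes "L > 0" "x \<in> star_graph k" "y \<in> star_graph k"
  shows "star_dist k L x y = (\<Sum>i=1..k. edge_length L i * \<bar>x i - y i\<bar>)"
  unfolding star_dist_def
  by (rule cInf_eq_minimum) (use star_path_lower star_path_exists assms in auto)

lemma star_conf_mono:
  assumes "r' \<le> r" "0 < L" "L \<le> L'"
  shows "star_conf k r L \<subseteq> star_conf k r' L'"
proof -
  have "star_dist k L x y \<le> star_dist k L' x y"
    if "x \<in> star_graph k" "y \<in> star_graph k" for x y
    using that assms
    by (auto simp: star_dist_eq edge_length_def intro!: sum_mono mult_right_mono)
  then show ?thesis
    using assms by (force simp: star_conf_def)
qed

lemma lookup_fsmult [simp]: "Poly_Mapping.lookup (fsmult c x) s = c * Poly_Mapping.lookup x s"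
  by (simp add: fsmult_def map.rep_eq when_def)

lemma keys_fsmult: "Poly_Mapping.keys (fsmult c x) \<subseteq> Poly_Mapping.keys x"
  by (auto simp: in_keys_iff)

lemma fsmult_simps:
  "fsmult c (x + y) = fsmult c x + fsmult c y"
  "fsmult (c + d) x = fsmult c x + fsmult d x"
  "fsmult c (fsmult d x) = fsmult (c * d) x"
  "fsmult 1 x = x" "fsmult 0 x = 0" "fsmult c 0 = 0"
  by (auto intro!: poly_mapping_eqI simp: lookup_add algebra_simps)

lemma fsmult_sum: "fsmult c (sum f A) = (\<Sum>a\<in>A. fsmult c (f a))"
  by (induction A rule: infinite_finite_induct) (auto simp: fsmult_simps)

lemma fextend_superset:
  assumes "finite S" "Poly_Mapping.keys x \<subseteq> S"
  shows "fextend b x = (\<Sum>s\<in>S. fsmult (Poly_Mapping.lookup x s) (b s))"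
  unfolding fextend_def
  by (rule sum.mono_neutral_left) (use assms in \<open>auto simp: in_keys_iff fsmult_simps\<close>)

lemma fextend_add: "fextend b (x + y) = fextend b x + fextend b y"
proof -
  let ?S = "Poly_Mapping.keys x \<union> Poly_Mapping.keys y"
  have "Poly_Mapping.keys (x + y) \<subseteq> ?S" by (rule keys_add)
  then show ?thesis
    by (simp add: fextend_superset[of ?S] lookup_add fsmult_simps sum.distrib)
qed

lemma fextend_smult: "fextend b (fsmult c x) = fsmult c (fextend b x)"
  using fextend_superset[OF finite_keys keys_fsmult, of b c x]
  by (simp add: fextend_def[of b x] fsmult_sum fsmult_simps)

lemma fextend_0 [simp]: "fextend b 0 = 0"
  by (simp add: fextend_def)

lemma fboundary_linear:
  "fboundary p (x + y) = fboundary p x + fboundary p y"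
  "fboundary p (fsmult c x) = fsmult c (fboundary p x)"
  "fboundary p 0 = 0"
  by (simp_all add: fboundary_def fextend_add fextend_smult fsmult_simps)

lemma fchains_closed:
  "0 \<in> fchains p U"
  "x \<in> fchains p U \<Longrightarrow> y \<in> fchains p U \<Longrightarrow> x + y \<in> fchains p U"
  "x \<in> fchains p U \<Longrightarrow> fsmult c x \<in> fchains p U"
  using keys_add[of x y] keys_fsmult[of c x] by (auto simp: fchains_def)

lemma fcycles_closed:
  "0 \<in> fcycles p U"
  "x \<in> fcycles p U \<Longrightarrow> y \<in> fcycles p U \<Longrightarrow> x + y \<in> fcycles p U"
  "x \<in> fcycles p U \<Longrightarrow> fsmult c x \<in> fcycles p U"
  by (auto simp: fcycles_def fchains_closed fboundary_linear fsmult_simps)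

lemma fboundaries_closed:
  "0 \<in> fboundaries p U"
  "x \<in> fboundaries p U \<Longrightarrow> y \<in> fboundaries p U \<Longrightarrow> x + y \<in> fboundaries p U"
  "x \<in> fboundaries p U \<Longrightarrow> fsmult c x \<in> fboundaries p U"
proof -
  show "0 \<in> fboundaries p U"
    unfolding fboundaries_def by (rule image_eqI[of _ _ 0]) (simp_all add: fchains_closed fboundary_linear)
  show "x + y \<in> fboundaries p U" if "x \<in> fboundaries p U" "y \<in> fboundaries p U"
    using that unfolding fboundaries_def
    by clarify (metis fboundary_linear(1) fchains_closed(2) image_eqI)
  show "fsmult c x \<in> fboundaries p U" if "x \<in> fboundaries p U"
    using that unfolding fboundaries_def
    by clarify (metis fboundary_linear(2) fchains_closed(3) image_eqI)
qed

lemma fsmult_minus_1: "fsmult (-1) x = - x"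
  by (auto intro!: poly_mapping_eqI simp: lookup_uminus)

lemma fboundaries_diff:
  "x \<in> fboundaries p U \<Longrightarrow> y \<in> fboundaries p U \<Longrightarrow> x - y \<in> fboundaries p U"
  using fboundaries_closed(2)[of x p U "fsmult (-1) y"] fboundaries_closed(3)[of y p U "-1"]
  by (simp add: fsmult_minus_1)

lemma in_fclass: "a \<in> fclass p U z \<longleftrightarrow> a - z \<in> fboundaries p U"
  by (auto simp: fclass_def) (metis add_diff_cancel_left' diff_add_cancel add.commute)

lemma fhomology_add:
  "fclass p U x \<oplus>\<^bsub>fhomology p U\<^esub> fclass p U y = fclass p U (x + y)"
proof (intro equalityI subsetI)
  fix a assume "a \<in> fclass p U x \<oplus>\<^bsub>fhomology p U\<^esub> fclass p U y"
  then obtain u v where "a = u + v" "u - x \<in> fboundaries p U" "v - y \<in> fboundaries p U"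
    by (auto simp: fhomology_def in_fclass)
  then show "a \<in> fclass p U (x + y)"
    using fboundaries_closed(2)[of "u - x" p U "v - y"] by (simp add: in_fclass algebra_simps)
next
  fix a assume "a \<in> fclass p U (x + y)"
  then have "a = (a - y) + y" "a - y \<in> fclass p U x" "y \<in> fclass p U y"
    by (auto simp: in_fclass algebra_simps fboundaries_closed)
  then show "a \<in> fclass p U x \<oplus>\<^bsub>fhomology p U\<^esub> fclass p U y"
    unfolding fhomology_def by simp (metis diff_add_cancel)
qed

lemma fhomology_smult:
  "c \<odot>\<^bsub>fhomology p U\<^esub> fclass p U x = fclass p U (fsmult c x)"
proof (intro equalityI subsetI)
  fix a assume "a \<in> c \<odot>\<^bsub>fhomology p U\<^esub> fclass p U x"
  then obtain b d where "a = fsmult c (x + d) + b" "d \<in> fboundaries p U" "b \<in> fboundaries p U"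
    by (auto simp: fhomology_def fclass_def)
  then show "a \<in> fclass p U (fsmult c x)"
    by (simp add: in_fclass fsmult_simps fboundaries_closed)
next
  fix a assume "a \<in> fclass p U (fsmult c x)"
  moreover have "x \<in> fclass p U x" by (simp add: in_fclass fboundaries_closed)
  ultimately show "a \<in> c \<odot>\<^bsub>fhomology p U\<^esub> fclass p U x"
    by (auto simp: fhomology_def fclass_def[of p U "fsmult c x"])
qed

lemma fhomology_zero: "\<zero>\<^bsub>fhomology p U\<^esub> = fclass p U 0"
  by (auto simp: fhomology_def fclass_def)

lemma fhomology_carrier: "carrier (fhomology p U) = fclass p U ` fcycles p U"
  by (simp add: fhomology_def)

lemma fhomology_vector_space: "vector_space_rec (fhomology p U :: ('f::field, ('a, 'f) fchain set) module)"
proof (rule moduleI)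
  show "cring (ring_of_type_algebra :: 'f ring)"
    by (rule cring_from_type_algebra)
  show "abelian_group (fhomology p U :: ('f, ('a, 'f) fchain set) module)"
  proof (rule abelian_groupI, goal_cases)
    case (6 A)
    then obtain x where x: "A = fclass p U x" "x \<in> fcycles p U"
      by (auto simp: fhomology_carrier)
    then show ?case
      using fcycles_closed(3)[of x p U "-1"]
      by (intro bexI[of _ "fclass p U (- x)"])
         (auto simp: fhomology_carrier fhomology_zero fhomology_add fsmult_minus_1)
  qed (auto simp: fhomology_carrier fhomology_zero fhomology_add fcycles_closed add_ac)
qed (auto simp: fhomology_carrier fhomology_zero fhomology_add fhomology_smult fcycles_closed
       fsmult_simps ring_of_type_algebra_def)

lemma fchain_map_id:
  assumes "c \<in> fchains p U"
  shows "fchain_map p (\<lambda>z. z) c = c"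
proof -
  have "simplex_map p (\<lambda>z. z) s = s" if "s \<in> Poly_Mapping.keys c" for s
    using that assms
    by (auto simp: fchains_def simplex_map_def singular_simplex_def o_def extensional_restrict)
  then have "fchain_map p (\<lambda>z. z) c
      = (\<Sum>s\<in>Poly_Mapping.keys c. Poly_Mapping.single s (Poly_Mapping.lookup c s))"
    unfolding fchain_map_def fextend_def
    by (intro sum.cong refl) (auto intro!: poly_mapping_eqI simp: lookup_single when_def)
  also have "\<dots> = c"
    by (auto intro!: poly_mapping_eqI
        simp: lookup_sum lookup_single when_def in_keys_iff)
  finally show ?thesis .
qed

lemma fchains_mono:
  "S \<subseteq> T \<Longrightarrow> fchains p (top_of_set S) \<subseteq> fchains p (top_of_set T)"
  by (force simp: fchains_def singular_simplex_def continuous_map_in_subtopology)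

lemma fboundary_fchains:
  assumes "c \<in> fchains (Suc p) U"
  shows "fboundary (Suc p) c \<in> fchains p U"
proof -
  have sum: "(\<Sum>a\<in>A. f a) \<in> fchains p U" if "\<And>a. a \<in> A \<Longrightarrow> f a \<in> fchains p U"
    for A :: "'d set" and f :: "'d \<Rightarrow> ('a, 'b) fchain"
    using that by (induction A rule: infinite_finite_induct) (auto simp: fchains_closed)
  have "Poly_Mapping.single (singular_face (Suc p) k s) ((-1) ^ k :: 'b) \<in> fchains p U"
    if "s \<in> Poly_Mapping.keys c" "k \<le> Suc p" for k s
    using that assms singular_simplex_singular_face[of "Suc p" U s k] by (auto simp: fchains_def)
  then show ?thesis
    unfolding fboundary_def fextend_def
    by (auto intro!: sum fchains_closed(3) simp del: sum.atMost_Suc)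
qed

lemma fhomology_map_class:
  assumes "S \<subseteq> T" "z \<in> fcycles p (top_of_set S)"
  shows "fhomology_map p (top_of_set T) (\<lambda>z. z) (fclass p (top_of_set S) z) = fclass p (top_of_set T) z"
proof -
  have BS: "fboundaries p (top_of_set S) \<subseteq> fboundaries p (top_of_set T)"
    unfolding fboundaries_def using fchains_mono[OF assms(1)] by blast
  have ch: "fchain_map p (\<lambda>z. z) a = a" if "a \<in> fclass p (top_of_set S) z" for a
  proof (rule fchain_map_id)
    show "a \<in> fchains p (top_of_set S)"
      using that assms(2) fboundary_fchains
      by (auto simp: fclass_def fboundaries_def fcycles_def intro!: fchains_closed(2))
  qed
  show ?thesis
  proof (intro equalityI subsetI)
    fix a assume "a \<in> fhomology_map p (top_of_set T) (\<lambda>z. z) (fclass p (top_of_set S) z)"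
    then obtain d b where "a = z + d + b" "d \<in> fboundaries p (top_of_set S)" "b \<in> fboundaries p (top_of_set T)"
      using ch unfolding fhomology_map_def by (auto simp: fclass_def)
    then show "a \<in> fclass p (top_of_set T) z"
      using BS by (auto simp: in_fclass algebra_simps intro!: fboundaries_closed)
  next
    fix a assume "a \<in> fclass p (top_of_set T) z"
    then obtain b where "a = z + b" "b \<in> fboundaries p (top_of_set T)"
      by (auto simp: fclass_def)
    moreover have "z \<in> fclass p (top_of_set S) z"
      by (simp add: in_fclass fboundaries_closed)
    ultimately show "a \<in> fhomology_map p (top_of_set T) (\<lambda>z. z) (fclass p (top_of_set S) z)"
      unfolding fhomology_map_def using ch by force
  qed
qed

lemma fcycles_mono:
  "S \<subseteq> T \<Longrightarrow> fcycles p (top_of_set S) \<subseteq> fcycles p (top_of_set T)"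
  unfolding fcycles_def using fchains_mono by blast

lemma star_PH_persistence_module:
  "persistence_module scale_poset scale_le (star_PH k i)"
  unfolding persistence_module_def
proof (intro conjI ballI impI)
  have mono: "star_conf k (fst p) (snd p) \<subseteq> star_conf k (fst q) (snd q)"
    if "p \<in> scale_poset" "scale_le p q" for p q
    using that star_conf_mono[of "fst q" "fst p" "snd p" "snd q" k]
    by (auto simp: scale_poset_def scale_le_def)
  have sp: "pspace (star_PH k i) p = fhomology i (top_of_set (star_conf k (fst p) (snd p)))" for p
    by (simp add: star_PH_def case_prod_beta)
  have mp: "pmap (star_PH k i) p q = fhomology_map i (top_of_set (star_conf k (fst q) (snd q))) (\<lambda>z. z)" for p q
    by (simp add: star_PH_def case_prod_beta)
  show "vector_space_rec (pspace (star_PH k i) p)" for p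
    unfolding sp by (rule fhomology_vector_space)
  show "linear_map (pspace (star_PH k i) p) (pspace (star_PH k i) q) (pmap (star_PH k i) p q)"
    if "p \<in> scale_poset" "scale_le p q" for p q
    using mono[OF that] fcycles_mono[OF mono[OF that], of i]
    by (auto simp: linear_map_def sp mp fhomology_carrier fhomology_map_class fhomology_add
        fhomology_smult fcycles_closed)
  show "pmap (star_PH k i) p p x = x" if "x \<in> carrier (pspace (star_PH k i) p)" for p x
    using that by (auto simp: sp mp fhomology_carrier fhomology_map_class)
  show "pmap (star_PH k i) q s (pmap (star_PH k i) p q x) = pmap (star_PH k i) p s x"
    if "p \<in> scale_poset" "q \<in> scale_poset" "scale_le p q" "scale_le q s"
      "x \<in> carrier (pspace (star_PH k i) p)" for p q s x
  proof -
    note x = that(5) and pq = mono[OF that(1,3)] and qs = mono[OF that(2,4)]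
    obtain z where z: "x = fclass i (top_of_set (star_conf k (fst p) (snd p))) z"
      "z \<in> fcycles i (top_of_set (star_conf k (fst p) (snd p)))"
      using x by (auto simp: sp fhomology_carrier)
    moreover have "z \<in> fcycles i (top_of_set (star_conf k (fst q) (snd q)))"
      using fcycles_mono[OF pq] z(2) by blast
    ultimately show ?thesis
      by (simp add: mp fhomology_map_class[OF pq] fhomology_map_class[OF qs]
          fhomology_map_class[OF subset_trans[OF pq qs]])
  qed
qed

end

theory Submission
  imports Defs
begin

text \<open>
  If \<open>r \<le> 1\<close>, let \<open>T\<close> be the set of edges of length at least \<open>r\<close>; it omits at most \<open>e\<^sub>1\<close>. Subtracting
  from \<open>x\<close> and \<open>y\<close> their common part, forgetting the coordinates outside \<open>T\<close> and scaling until one of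
  the points reaches a leaf maps the configuration space onto a graph that depends on \<open>T\<close> only, and the
  straight line homotopy to this map never decreases the distance below \<open>r\<close>. So for \<open>r \<le> 1\<close> the
  homology takes only two values, according to whether \<open>L < r\<close> or not, and all structure maps between
  equal values are isomorphisms. The smaller graph is a retract of the larger one, because it is path
  connected (as \<open>k \<ge> 4\<close>) and the larger graph arises from it by attaching two cones over finite sets.
  If \<open>r > 1\<close>, every component is contractible. Hence cycles of the smaller graph representing a basis of
  its homology, completed to such a family for the larger graph, decompose the module into copies of the
  interval modules on \<open>{r \<le> 1}\<close> and on \<open>{r \<le> min 1 L}\<close>.
\<close>

section \<open>Chain maps and homotopies\<close>

text \<open>Interval decomposability is not automatic over a two-parameter poset. It holds here
  because the bases consist of actual cycles: each model graph lies inside every configuration space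
  that it models, and the smaller graph lies inside the larger one. A single chain therefore
  represents its class at every scale of its interval, and the structure maps, being induced by
  inclusions, carry it to itself. The deformations at different scales are never compared. The one
  remaining danger is a class that dies on passing from the smaller graph to the larger; the
  retraction excludes this, since it makes the map on homology injective.

  For a set \<open>T\<close> of n edges the model graph is the complete bipartite graph on two
  copies of \<open>T\<close>, without the n edges that join an element to its own copy. It is
  connected for n at least 3 and splits into two arcs for n = 2. As \<open>{2..k}\<close> has k - 1
  elements, this is where k >= 4 enters.

  Only degree one occurs, so homotopy invariance and the vanishing of the squared boundary are
  checked there with explicit triangles.\<close>

lemma fextend_single: "fextend b (Poly_Mapping.single s c) = fsmult c (b s)"
  by (cases "c = 0") (simp_all add: fextend_def fsmult_simps)

lemma fextend_sum: "fextend b (sum f A) = (\<Sum>a\<in>A. fextend b (f a))"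
  by (induction A rule: infinite_finite_induct) (auto simp: fextend_add)

lemma fsmult_diff: "fsmult c (x - y) = fsmult c x - fsmult c y"
  by (rule poly_mapping_eqI) (simp add: lookup_minus right_diff_distrib)

lemma fextend_diff: "fextend b (x - y) = fextend b x - fextend b y"
  using fextend_add[of b "x - y" y] by simp

lemma fextend_diff_fun: "fextend (\<lambda>s. a s - b s) x = fextend a x - fextend b x"
  by (simp add: fextend_def fsmult_diff sum_subtractf)

lemma fextend_fextend: "fextend a (fextend b x) = fextend (\<lambda>s. fextend a (b s)) x"
  by (simp add: fextend_def[of b x] fextend_def[of _ x] fextend_sum fextend_smult)

lemma fextend_cong:
  "(\<And>s. s \<in> Poly_Mapping.keys x \<Longrightarrow> a s = b s) \<Longrightarrow> fextend a x = fextend b x"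
  by (simp add: fextend_def)

lemma fextend_single_id: "fextend (\<lambda>s. Poly_Mapping.single s 1) x = x"
proof -
  have "fextend (\<lambda>s. Poly_Mapping.single s 1) x
      = (\<Sum>s\<in>Poly_Mapping.keys x. Poly_Mapping.single s (Poly_Mapping.lookup x s))"
    unfolding fextend_def
    by (intro sum.cong refl) (auto intro!: poly_mapping_eqI simp: lookup_single when_def)
  also have "\<dots> = x"
    by (auto intro!: poly_mapping_eqI simp: lookup_sum lookup_single when_def in_keys_iff)
  finally show ?thesis .
qed

lemma fsmult_single: "fsmult c (Poly_Mapping.single s d) = Poly_Mapping.single s (c * d)"
  by (auto intro!: poly_mapping_eqI simp: lookup_single when_def)

lemma fchains_sum: "(\<And>a. a \<in> A \<Longrightarrow> f a \<in> fchains p U) \<Longrightarrow> sum f A \<in> fchains p U"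
  by (induction A rule: infinite_finite_induct) (auto simp: fchains_closed)

lemma fextend_in_fchains:
  "(\<And>s. s \<in> Poly_Mapping.keys x \<Longrightarrow> b s \<in> fchains p U) \<Longrightarrow> fextend b x \<in> fchains p U"
  unfolding fextend_def by (intro fchains_sum fchains_closed)

lemma fchains_diff:
  "x \<in> fchains p U \<Longrightarrow> y \<in> fchains p U \<Longrightarrow> x - y \<in> fchains p U"
  using fchains_closed(2)[of x p U "fsmult (-1) y"] fchains_closed(3)[of y p U "-1"]
  by (simp add: fsmult_minus_1)

lemma single_in_fchains:
  "singular_simplex p U s \<Longrightarrow> Poly_Mapping.single s c \<in> fchains p U"
  by (auto simp: fchains_def)

lemma fchain_map_in_fchains:
  assumes "c \<in> fchains p U" "continuous_map U V g"
  shows "fchain_map p g c \<in> fchains p V"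
  unfolding fchain_map_def
  by (rule fextend_in_fchains)
     (use assms in \<open>auto intro!: single_in_fchains intro: singular_simplex_simplex_map simp: fchains_def\<close>)

lemma fboundary_fchain_map:
  "fboundary (Suc p) (fchain_map (Suc p) g c) = fchain_map p g (fboundary (Suc p) c)"
proof -
  have "simplex_map p g (s \<circ> simplical_face i) = simplex_map p g (singular_face (Suc p) i s)" for s i
    by (auto simp: simplex_map_def singular_face_def)
  then show ?thesis
    by (auto simp: fboundary_def fchain_map_def fextend_fextend fextend_single fextend_sum
        fsmult_simps fsmult_single singular_face_simplex_map simp del: sum.atMost_Suc
        intro!: fextend_cong sum.cong)
qed

lemma fchain_map_in_fcycles:
  assumes "z \<in> fcycles (Suc p) U" "continuous_map U V g"
  shows "fchain_map (Suc p) g z \<in> fcycles (Suc p) V"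
  using assms fchain_map_in_fchains[OF _ assms(2)]
  by (auto simp: fcycles_def fboundary_fchain_map) (simp add: fchain_map_def)

lemma fchain_map_in_fboundaries:
  assumes "z \<in> fboundaries p U" "continuous_map U V g"
  shows "fchain_map p g z \<in> fboundaries p V"
  using assms fchain_map_in_fchains[OF _ assms(2)]
  by (force simp: fboundaries_def fboundary_fchain_map[symmetric])

lemma fchain_map_eq_self:
  assumes "c \<in> fchains p U" "\<And>x. x \<in> topspace U \<Longrightarrow> g x = x"
  shows "fchain_map p g c = c"
proof -
  have "fchain_map p g c = fextend (\<lambda>s. Poly_Mapping.single s 1) c"
    unfolding fchain_map_def
    by (rule fextend_cong)
       (use assms simplex_map_id_gen[of p U _ g] in \<open>auto simp: fchains_def\<close>)
  then show ?thesis by (simp add: fextend_single_id)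
qed

lemma singular_face_singular_face_2:
  assumes "i \<le> j" "j \<le> 1"
  shows "singular_face 1 i (singular_face 2 (Suc j) s) = singular_face 1 j (singular_face 2 i s)"
proof -
  have face: "simplical_face l t \<in> standard_simplex 1" if "t \<in> standard_simplex 0" "l \<le> 1" for l t
    using simplical_face_in_standard_simplex[of 1 l t] that by simp
  have "simplical_face (Suc j) (simplical_face i t) = simplical_face i (simplical_face j t)"
    for t :: "nat \<Rightarrow> real"
    using assms unfolding simplical_face_def by fastforce
  then show ?thesis
    using face assms unfolding singular_face_def by (intro ext) (simp add: restrict_def)
qed

lemma fboundaries_subset_fcycles_1:
  "fboundaries 1 U \<subseteq> (fcycles 1 U :: ('a, 'f::field) fchain set)"
proof
  fix z :: "('a, 'f) fchain"
  assume "z \<in> fboundaries 1 U"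
  then obtain c where c: "c \<in> fchains 2 U" "z = fboundary 2 c"
    by (auto simp: fboundaries_def numeral_2_eq_2)
  have two: "{..2::nat} = {0, 1, 2}" and one: "{..1::nat} = {0, 1}" by auto
  \<comment> \<open>These three identities pair off the six vertex terms of the double boundary of a
    triangle, with opposite signs in each pair.\<close>
  have face: "singular_face 1 0 (singular_face 2 1 s) = singular_face 1 0 (singular_face 2 0 s)"
    "singular_face 1 0 (singular_face 2 2 s) = singular_face 1 1 (singular_face 2 0 s)"
    "singular_face 1 1 (singular_face 2 2 s) = singular_face 1 1 (singular_face 2 1 s)"
    for s :: "(nat \<Rightarrow> real) \<Rightarrow> 'a"
    using singular_face_singular_face_2[of 0 0 s] singular_face_singular_face_2[of 0 1 s]
      singular_face_singular_face_2[of 1 1 s] by (simp_all add: numeral_2_eq_2)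
  have "fboundary 1 z = fextend (\<lambda>s. 0) c"
    unfolding c(2) fboundary_def fextend_fextend
    by (simp add: fextend_fextend two one[unfolded One_nat_def] del: sum.atMost_Suc)
       (rule fextend_cong, simp add: fextend_diff fextend_add fextend_single fsmult_simps
         fsmult_single single_uminus face[unfolded One_nat_def])
  also have "\<dots> = 0" by (simp add: fextend_def fsmult_simps)
  moreover have "z \<in> fchains 1 U"
    using fboundary_fchains[of c 1 U] c by (simp add: numeral_2_eq_2)
  ultimately show "z \<in> fcycles 1 U" by (simp add: fcycles_def)
qed

section \<open>Homotopy invariance for 1-cycles: the prism operator\<close>

text \<open>One of the two triangles into which the diagonal cuts the square [0,1] x edge. With v0,
  v1 the ends of the edge, its vertices are (0,v0), (1,v0), (1,v1); those of
  \<open>prism_lower\<close> are (0,v0), (0,v1), (1,v1). Face 1 of both is the diagonal.\<close>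

definition prism_upper ::
    "(real \<times> 'a \<Rightarrow> 'b) \<Rightarrow> ((nat \<Rightarrow> real) \<Rightarrow> 'a) \<Rightarrow> (nat \<Rightarrow> real) \<Rightarrow> 'b" where
  "prism_upper h s = (\<lambda>t\<in>standard_simplex 2.
     h (t 1 + t 2, s (\<lambda>i. if i = 0 then t 0 + t 1 else if i = 1 then t 2 else 0)))"

definition prism_lower ::
    "(real \<times> 'a \<Rightarrow> 'b) \<Rightarrow> ((nat \<Rightarrow> real) \<Rightarrow> 'a) \<Rightarrow> (nat \<Rightarrow> real) \<Rightarrow> 'b" where
  "prism_lower h s = (\<lambda>t\<in>standard_simplex 2.
     h (t 2, s (\<lambda>i. if i = 0 then t 0 else if i = 1 then t 1 + t 2 else 0)))"

text \<open>The track of a vertex under the homotopy. The 0-simplex \<open>v\<close> is evaluated at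
  the only point of \<open>standard_simplex 0\<close>.\<close>

definition prism_vertical ::
    "(real \<times> 'a \<Rightarrow> 'b) \<Rightarrow> ((nat \<Rightarrow> real) \<Rightarrow> 'a) \<Rightarrow> (nat \<Rightarrow> real) \<Rightarrow> 'b" where
  "prism_vertical h v = (\<lambda>t\<in>standard_simplex 1. h (t 1, v (\<lambda>i. if i = 0 then 1 else 0)))"

lemma standard_simplex_1_iff:
  "t \<in> standard_simplex 1 \<longleftrightarrow> 0 \<le> t 0 \<and> 0 \<le> t 1 \<and> t 0 + t 1 = 1 \<and> (\<forall>i>1. t i = 0)"
  unfolding standard_simplex_def
  by (auto, (metis add.commute add_increasing le_add_same_cancel2 less_one linorder_neqE_nat
      One_nat_def order_refl zero_le_one)+)

lemma standard_simplex_2_iff: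
  "t \<in> standard_simplex 2 \<longleftrightarrow>
     0 \<le> t 0 \<and> 0 \<le> t 1 \<and> 0 \<le> t 2 \<and> t 0 + t 1 + t 2 = 1 \<and> (\<forall>i>2. t i = 0)"
proof -
  have *: "i = 0 \<or> i = 1 \<or> i = 2 \<or> i > 2" for i :: nat by linarith
  show ?thesis
    unfolding standard_simplex_def
    apply (auto simp: numeral_2_eq_2)
    subgoal for i using *[of i] by (auto simp: numeral_2_eq_2)
    subgoal for i using *[of i] by (auto simp: numeral_2_eq_2)
    done
qed

lemma standard_simplex_1_eta:
  assumes "t \<in> standard_simplex 1"
  shows "(\<lambda>i. if i = 0 then t 0 else if i = 1 then t 1 else 0) = t"
  using assms by (auto simp: standard_simplex_1_iff[unfolded One_nat_def] fun_eq_iff)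

lemma singular_simplex_iff_top_of_set:
  "singular_simplex p U s \<longleftrightarrow>
     continuous_map (top_of_set (standard_simplex p)) U s \<and> s \<in> extensional (standard_simplex p)"
  by (simp add: singular_simplex_def euclidean_product_topology)

lemma singular_simplex_restrict_homotopy:
  assumes h: "continuous_map (prod_topology (top_of_set {0..1}) U) V h"
    and s: "singular_simplex p U s"
    and u: "continuous_on (standard_simplex q) u" "u \<in> standard_simplex q \<rightarrow> {0..1}"
    and w: "continuous_on (standard_simplex q) w" "w \<in> standard_simplex q \<rightarrow> standard_simplex p"
  shows "singular_simplex q V (\<lambda>t\<in>standard_simplex q. h (u t, s (w t)))"
proof -
  have "continuous_map (top_of_set (standard_simplex q)) U (s \<circ> w)"
    by (rule continuous_map_compose[of _ "top_of_set (standard_simplex p)"])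
       (use s w in \<open>auto simp: singular_simplex_iff_top_of_set\<close>)
  then have "continuous_map (top_of_set (standard_simplex q)) (prod_topology (top_of_set {0..1}) U)
      (\<lambda>t. (u t, s (w t)))"
    using u by (auto simp: continuous_map_pairwise o_def)
  from continuous_map_compose[OF this h]
  have "continuous_map (top_of_set (standard_simplex q)) V (\<lambda>t. h (u t, s (w t)))"
    by (simp add: o_def)
  then show ?thesis
    by (auto simp: singular_simplex_iff_top_of_set intro: continuous_map_eq)
qed

lemma simplex_map_as_restrict:
  "simplex_map 1 f s = (\<lambda>t\<in>standard_simplex 1. f (s t))"
  by (simp add: simplex_map_def o_def)

context
  fixes U :: "'a topology" and V :: "'b topology" and h :: "real \<times> 'a \<Rightarrow> 'b"
  assumes h: "continuous_map (prod_topology (top_of_set {0..1}) U) V h"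
begin

lemma singular_simplex_prism:
  assumes "singular_simplex 1 U s"
  shows "singular_simplex 2 V (prism_upper h s)" "singular_simplex 2 V (prism_lower h s)"
proof -
  have p: "continuous_on (standard_simplex 2) (\<lambda>t. t i)" for i :: nat
    by (rule continuous_on_product_then_coordinatewise) (rule continuous_on_id)
  have c: "continuous_on (standard_simplex 2) (\<lambda>t. \<lambda>i::nat. if i = 0 then a t else if i = 1 then b t else 0)"
    if "continuous_on (standard_simplex 2) a" "continuous_on (standard_simplex 2) b"
    for a b :: "(nat \<Rightarrow> real) \<Rightarrow> real"
  proof (rule continuous_on_coordinatewise_then_product)
    fix i :: nat
    show "continuous_on (standard_simplex 2) (\<lambda>t. if i = 0 then a t else if i = 1 then b t else 0)"
      using that by (cases "i = 0"; cases "i = 1") simp_all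
  qed
  show "singular_simplex 2 V (prism_upper h s)"
    unfolding prism_upper_def
  proof (rule singular_simplex_restrict_homotopy[OF h assms])
    show "continuous_on (standard_simplex 2) (\<lambda>t. t 1 + t 2 :: real)"
      by (intro p continuous_on_add)
    show "(\<lambda>t. t 1 + t 2) \<in> standard_simplex 2 \<rightarrow> {0..1::real}"
      by (auto simp: standard_simplex_2_iff)
    show "continuous_on (standard_simplex 2) (\<lambda>t (i::nat). if i = 0 then t 0 + t 1 else if i = 1 then t 2 else 0 :: real)"
      by (intro c p continuous_on_add)
    show "(\<lambda>t (i::nat). if i = 0 then t 0 + t 1 else if i = 1 then t 2 else 0) \<in> standard_simplex 2 \<rightarrow> standard_simplex 1"
      unfolding standard_simplex_1_iff by (auto simp: standard_simplex_2_iff standard_simplex_1_iff[unfolded One_nat_def])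
  qed
  show "singular_simplex 2 V (prism_lower h s)"
    unfolding prism_lower_def
  proof (rule singular_simplex_restrict_homotopy[OF h assms])
    show "continuous_on (standard_simplex 2) (\<lambda>t. t 2 :: real)"
      by (intro p continuous_on_add)
    show "(\<lambda>t. t 2) \<in> standard_simplex 2 \<rightarrow> {0..1::real}"
      by (auto simp: standard_simplex_2_iff)
    show "continuous_on (standard_simplex 2) (\<lambda>t (i::nat). if i = 0 then t 0 else if i = 1 then t 1 + t 2 else 0 :: real)"
      by (intro c p continuous_on_add)
    show "(\<lambda>t (i::nat). if i = 0 then t 0 else if i = 1 then t 1 + t 2 else 0) \<in> standard_simplex 2 \<rightarrow> standard_simplex 1"
      unfolding standard_simplex_1_iff by (auto simp: standard_simplex_2_iff standard_simplex_1_iff[unfolded One_nat_def])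
  qed
qed

lemma prism_faces:
  "singular_face 2 0 (prism_upper h s) = simplex_map 1 (\<lambda>x. h (1, x)) s"
  "singular_face 2 2 (prism_upper h s) = prism_vertical h (singular_face 1 1 s)"
  "singular_face 2 0 (prism_lower h s) = prism_vertical h (singular_face 1 0 s)"
  "singular_face 2 2 (prism_lower h s) = simplex_map 1 (\<lambda>x. h (0, x)) s"
  "singular_face 2 1 (prism_lower h s) = singular_face 2 1 (prism_upper h s)"
proof -
  have f: "singular_face 2 i (restrict F (standard_simplex 2))
      = (\<lambda>t\<in>standard_simplex 1. F (simplical_face i t))" if "i \<le> 2" for i and F :: "_ \<Rightarrow> 'b"
    using simplical_face_in_standard_simplex[of 2 i] that
    by (auto simp: singular_face_def fun_eq_iff restrict_def)
  have e: "(\<lambda>i::nat. if i = 0 then 1 else 0::real) \<in> standard_simplex 0"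
    by (simp add: standard_simplex_0)
  have v: "singular_face 1 i s (\<lambda>i::nat. if i = 0 then 1 else 0)
      = s (simplical_face i (\<lambda>i. if i = 0 then 1 else 0))" for i
    using e by (simp add: singular_face_def)
  have t: "t 0 + t 1 = 1" "t 0 + t (Suc 0) = 1" if "t \<in> standard_simplex 1" for t
    using that standard_simplex_1_iff[of t] by auto
  have v0: "simplical_face 1 (\<lambda>i. if i = 0 then 1 else 0) = (\<lambda>i. if i = 0 then 1 else 0 :: real)"
    "simplical_face 0 (\<lambda>i. if i = 0 then 1 else 0) = (\<lambda>i. if i = 1 then 1 else 0 :: real)"
    by (auto simp: simplical_face_def fun_eq_iff)
  note d = prism_upper_def prism_lower_def prism_vertical_def simplex_map_as_restrict v
  have if01: "(\<lambda>i. if i = 0 then 0 else if i = 1 then 1 else 0) = (\<lambda>i::nat. if i = 1 then 1 else 0::real)"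
    "(\<lambda>i. if i = 0 then 0 else if i \<le> Suc 0 then 1 else 0)
      = (\<lambda>i::nat. if i = 0 then 0 else if i = Suc 0 then 1 else 0::real)"
    "(\<lambda>i. if i = 0 then 1 else if i = 1 then 0 else 0) = (\<lambda>i::nat. if i = 0 then 1 else 0::real)"
    by auto
  have sf: "simplical_face 0 t = (\<lambda>i. if i = 0 then 0 else t (i - 1))"
    "simplical_face 1 t 0 = t 0" "simplical_face 1 t 1 = 0" "simplical_face 1 t 2 = t 1"
    "simplical_face 2 t 0 = t 0" "simplical_face 2 t 1 = t 1" "simplical_face 2 t 2 = 0"
    for t :: "nat \<Rightarrow> real"
    by (auto simp: simplical_face_def)
  note sf = sf sf[unfolded One_nat_def] v0 v0[unfolded One_nat_def]
  show "singular_face 2 0 (prism_upper h s) = simplex_map 1 (\<lambda>x. h (1, x)) s"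
    unfolding d f[OF le0] by (rule restrict_ext) (simp add: sf t standard_simplex_1_eta[unfolded One_nat_def] cong: if_cong)
  show "singular_face 2 2 (prism_upper h s) = prism_vertical h (singular_face 1 1 s)"
    unfolding d f[OF order_refl] by (rule restrict_ext) (simp add: sf t if01 cong: if_cong)
  show "singular_face 2 0 (prism_lower h s) = prism_vertical h (singular_face 1 0 s)"
    unfolding d f[OF le0] by (rule restrict_ext) (simp add: sf t if01 cong: if_cong)
  show "singular_face 2 2 (prism_lower h s) = simplex_map 1 (\<lambda>x. h (0, x)) s"
    unfolding d f[OF order_refl] by (rule restrict_ext) (simp add: sf t standard_simplex_1_eta[unfolded One_nat_def] cong: if_cong)
  show "singular_face 2 1 (prism_lower h s) = singular_face 2 1 (prism_upper h s)"
    unfolding prism_upper_def prism_lower_def f[OF one_le_numeral] by (rule restrict_ext) (simp add: sf cong: if_cong)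
qed

text \<open>In the boundary of upper minus lower triangles the diagonals cancel. What is left is the
  edge at time 1, minus the edge at time 0, minus the vertical tracks of its boundary. The last part
  depends linearly on the boundary, so it vanishes on a cycle.\<close>

lemma homotopy_fchain_map_diff:
  fixes z :: "('a, 'f::field) fchain"
  assumes z: "z \<in> fcycles 1 U"
  shows "fchain_map 1 (\<lambda>x. h (1, x)) z - fchain_map 1 (\<lambda>x. h (0, x)) z \<in> fboundaries 1 V"
proof -
  let ?P = "\<lambda>s. Poly_Mapping.single (prism_upper h s) (1::'f) - Poly_Mapping.single (prism_lower h s) 1"
  let ?W = "\<lambda>v. Poly_Mapping.single (prism_vertical h v) (1::'f)"
  have "fextend ?P z \<in> fchains 2 V"
    using z by (intro fextend_in_fchains fchains_diff single_in_fchains singular_simplex_prism)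
      (auto simp: fcycles_def fchains_def)
  moreover have "fboundary 2 (fextend ?P z)
      = fchain_map 1 (\<lambda>x. h (1, x)) z - fchain_map 1 (\<lambda>x. h (0, x)) z - fextend ?W (fboundary 1 z)"
  proof -
    have two: "{..2::nat} = {0,1,2}" and one: "{..Suc 0} = {0,1}" by auto
    show ?thesis
      unfolding fboundary_def fchain_map_def
      by (simp add: fextend_fextend fextend_diff_fun[symmetric] two one del: sum.atMost_Suc)
         (rule fextend_cong, simp add: fextend_diff fextend_add fextend_single fsmult_simps
           fsmult_single prism_faces[unfolded One_nat_def] single_uminus algebra_simps)
  qed
  moreover have "fboundary 1 z = 0" using z by (simp add: fcycles_def)
  ultimately show ?thesis
    unfolding fboundaries_def by (auto simp: numeral_2_eq_2 intro!: image_eqI[of _ _ "fextend ?P z"])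
qed

end

interpretation fchain_vs: vector_space "fsmult :: 'f::field \<Rightarrow> ('b \<Rightarrow>\<^sub>0 'f) \<Rightarrow> _"
  by unfold_locales (simp_all add: fsmult_simps)

lemma subspace_fcycles: "fchain_vs.subspace (fcycles p U)"
  by (auto simp: fchain_vs.subspace_def fcycles_closed)

lemma subspace_fboundaries: "fchain_vs.subspace (fboundaries p U)"
  by (auto simp: fchain_vs.subspace_def fboundaries_closed)

lemma singular_simplex_const:
  "a \<in> topspace U \<Longrightarrow> singular_simplex p U (\<lambda>t\<in>standard_simplex p. a)"
  by (auto simp: singular_simplex_iff_top_of_set
      intro: continuous_map_eq[OF continuous_map_const[THEN iffD2]])

text \<open>The three faces of a constant triangle are the same constant edge with signs +, -, +, so
  the boundary of the triangle is that edge.\<close>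

lemma const_simplex_in_fboundaries:
  assumes "a \<in> topspace U"
  shows "Poly_Mapping.single (\<lambda>t\<in>standard_simplex 1. a) (1::'f::field) \<in> fboundaries 1 U"
proof -
  have face: "singular_face 2 i (\<lambda>t\<in>standard_simplex 2. a) = (\<lambda>t\<in>standard_simplex 1. a)"
    if "i \<le> 2" for i
    using simplical_face_in_standard_simplex[of 2 i] that
    by (auto simp: singular_face_def fun_eq_iff restrict_def)
  have two: "{..2::nat} = {0,1,2}" by auto
  have "fboundary 2 (Poly_Mapping.single (\<lambda>t\<in>standard_simplex 2. a) (1::'f))
      = Poly_Mapping.single (\<lambda>t\<in>standard_simplex 1. a) 1"
    by (simp add: fboundary_def fextend_single fsmult_simps two face[unfolded One_nat_def] single_uminus
        del: singular_face_restrict)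
  moreover have "Poly_Mapping.single (\<lambda>t\<in>standard_simplex 2. a) (1::'f) \<in> fchains 2 U"
    by (intro single_in_fchains singular_simplex_const assms)
  ultimately show ?thesis
    unfolding fboundaries_def Suc_1 by (metis image_eqI Suc_1 One_nat_def)
qed

lemma fextend_in_fboundaries:
  assumes "\<And>s. s \<in> Poly_Mapping.keys x \<Longrightarrow> b s \<in> fboundaries p U"
  shows "fextend b x \<in> fboundaries p U"
  unfolding fextend_def
  by (rule fchain_vs.subspace_sum[OF subspace_fboundaries])
     (use assms in \<open>auto intro: fboundaries_closed\<close>)

text \<open>An edge is connected and a finite set in a metric space is discrete, so the end map
  sends every edge to a constant one. Hence a cycle is homologous to a combination of constant
  edges, which bounds. This kills the homology for r > 1.\<close>

lemma fcycles_1_subset_fboundaries: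
  fixes S :: "'a::metric_space set" and h :: "real \<times> 'a \<Rightarrow> 'a"
  assumes h: "continuous_map (prod_topology (top_of_set {0..1}) (top_of_set S)) (top_of_set S) h"
    and h0: "\<And>x. x \<in> S \<Longrightarrow> h (0, x) = x"
    and fin: "finite ((\<lambda>x. h (1, x)) ` S)"
  shows "fcycles 1 (top_of_set S) \<subseteq> (fboundaries 1 (top_of_set S) :: ('a, 'f::field) fchain set)"
proof
  fix z :: "('a, 'f) fchain"
  assume z: "z \<in> fcycles 1 (top_of_set S)"
  let ?f = "\<lambda>x. h (1, x)"
  have cont: "continuous_map (top_of_set S) (top_of_set S) ?f"
  proof -
    have "continuous_map (top_of_set S) (prod_topology (top_of_set {0..1}) (top_of_set S)) (\<lambda>x. (1::real, x))"
      by (auto intro!: continuous_intros)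
    from continuous_map_compose[OF this h] show ?thesis by (simp add: o_def)
  qed
  have "fchain_map 1 ?f z \<in> fboundaries 1 (top_of_set S)"
    unfolding fchain_map_def
  proof (rule fextend_in_fboundaries)
    fix s assume "s \<in> Poly_Mapping.keys z"
    then have s: "singular_simplex 1 (top_of_set S) s"
      using z by (auto simp: fcycles_def fchains_def)
    then have sub: "s ` standard_simplex 1 \<subseteq> S" and
      cs: "continuous_on (standard_simplex 1) s"
      by (auto simp: singular_simplex_iff_top_of_set)
    have "connected (standard_simplex 1)"
      using connectedin_standard_simplex[of 1]
      by (simp add: euclidean_product_topology)
    moreover have "continuous_on (standard_simplex 1) (?f \<circ> s)"
      using continuous_on_compose[OF cs, of ?f] cont continuous_on_subset[OF _ sub] by auto
    ultimately have "connected ((?f \<circ> s) ` standard_simplex 1)"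
      by (rule connected_continuous_image[rotated])
    moreover have "finite ((?f \<circ> s) ` standard_simplex 1)"
      by (rule finite_subset[OF _ fin]) (use sub in auto)
    ultimately obtain a where a: "(?f \<circ> s) ` standard_simplex 1 = {a}"
      using connected_finite_iff_sing nonempty_standard_simplex[of 1] by blast
    have "simplex_map 1 ?f s = (\<lambda>t\<in>standard_simplex 1. a)"
      using a by (auto simp: simplex_map_def fun_eq_iff)
    moreover have "a \<in> S"
    proof -
      have "a \<in> (?f \<circ> s) ` standard_simplex 1" using a by simp
      then show ?thesis using sub cont by (auto simp: Pi_iff)
    qed
    ultimately show "Poly_Mapping.single (simplex_map 1 ?f s) (1::'f) \<in> fboundaries 1 (top_of_set S)"
      using const_simplex_in_fboundaries[of a "top_of_set S"] by simp
  qed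
  moreover have "fchain_map 1 (\<lambda>x. h (0, x)) z = z"
    by (rule fchain_map_eq_self[of _ _ "top_of_set S"]) (use z h0 in \<open>auto simp: fcycles_def\<close>)
  ultimately show "z \<in> fboundaries 1 (top_of_set S)"
    using fboundaries_diff[OF _ homotopy_fchain_map_diff[OF h z]] by fastforce
qed

section \<open>Interval decompositions from adapted bases\<close>

lemma fclass_eq_iff: "fclass p U x = fclass p U y \<longleftrightarrow> x - y \<in> fboundaries p U"
proof
  assume "fclass p U x = fclass p U y"
  moreover have "x \<in> fclass p U x" by (simp add: in_fclass fboundaries_closed)
  ultimately show "x - y \<in> fboundaries p U" by (simp add: in_fclass)
next
  assume xy: "x - y \<in> fboundaries p U"
  have "a - x \<in> fboundaries p U \<longleftrightarrow> a - y \<in> fboundaries p U" for a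
    using fboundaries_closed(2)[OF _ xy, of "a - x"] fboundaries_diff[OF _ xy, of "a - y"] by auto
  then show "fclass p U x = fclass p U y" by (auto simp: in_fclass)
qed

definition filtration_PH ::
    "nat \<Rightarrow> ('p \<Rightarrow> 'a::topological_space set) \<Rightarrow> ('p, 'f::field, ('a, 'f) fchain set) pmod" where
  "filtration_PH n S =
     \<lparr>pspace = (\<lambda>p. fhomology n (top_of_set (S p))),
      pmap = (\<lambda>p q. fhomology_map n (top_of_set (S q)) (\<lambda>z. z))\<rparr>"

text \<open>By \<open>ex\<close> and \<open>uniq\<close> the members of \<open>B\<close> alive at
  \<open>p\<close> represent a basis of the homology there. Since the same chain serves at all
  scales of its interval and intervals are closed upwards, the structure maps leave the coordinates
  unchanged, and taking coordinates is the isomorphism.\<close>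

lemma interval_decomposable_of_adapted_basis:
  fixes S :: "'p \<Rightarrow> 'a::topological_space set" and B :: "('a, 'f::field) fchain set"
  assumes mono: "\<And>p q. p \<in> P \<Longrightarrow> q \<in> P \<Longrightarrow> ple p q \<Longrightarrow> S p \<subseteq> S q"
    and ind: "fchain_vs.independent B"
    and int: "\<And>b. b \<in> B \<Longrightarrow> poset_interval P ple (I b)"
    and up: "\<And>b p q. b \<in> B \<Longrightarrow> p \<in> I b \<Longrightarrow> q \<in> P \<Longrightarrow> ple p q \<Longrightarrow> q \<in> I b"
    and cyc: "\<And>b p. b \<in> B \<Longrightarrow> p \<in> I b \<Longrightarrow> b \<in> fcycles n (top_of_set (S p))"
    and ex: "\<And>p z. p \<in> P \<Longrightarrow> z \<in> fcycles n (top_of_set (S p)) \<Longrightarrow>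
        \<exists>w \<in> fchain_vs.span {b\<in>B. p \<in> I b}. z - w \<in> fboundaries n (top_of_set (S p))"
    and uniq: "\<And>p w. p \<in> P \<Longrightarrow> w \<in> fchain_vs.span {b\<in>B. p \<in> I b} \<Longrightarrow>
        w \<in> fboundaries n (top_of_set (S p)) \<Longrightarrow> w = 0"
  shows "interval_decomposable P ple
           (filtration_PH n S :: ('p, 'f, ('a, 'f) fchain set) pmod)"
proof -
  let ?T = "\<lambda>p. top_of_set (S p)"
  let ?R = "fchain_vs.representation B"
  define Bp where "Bp p = {b\<in>B. p \<in> I b}" for p
  define el :: "'p set \<times> ('a, 'f) fchain set \<Rightarrow> ('a, 'f) fchain" where "el j = the_elem (snd j)" for j
  \<comment> \<open>The prescribed index type pairs a set of scales with a set of chains. A chain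
    \<open>b\<close> is coded by its singleton next to the dummy \<open>UNIV\<close>, and
    \<open>el\<close> decodes it.\<close>
  define J :: "('p set \<times> ('a, 'f) fchain set) set" where "J = (\<lambda>b. (UNIV, {b})) ` B"
  define N where "N = pmod_direct_sum J (\<lambda>j. interval_module (I (el j)) :: ('p, 'f, 'f) pmod)"
  \<comment> \<open>The canonical representative of a class among the combinations of live members:
    \<open>ex\<close> provides it and \<open>uniq\<close> makes it unique.\<close>
  define C where "C p A = (THE w. w \<in> fchain_vs.span (Bp p) \<and> A = fclass n (?T p) w)" for p A
  define h where "h p A = (\<lambda>j\<in>J. ?R (C p A) (el j))" for p A
  have el [simp]: "el (UNIV, {b}) = b" for b by (simp add: el_def)
  have elJ: "el j \<in> B" if "j \<in> J" for j using that by (auto simp: J_def)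
  have BpB: "Bp p \<subseteq> B" for p by (auto simp: Bp_def)
  have spB: "w \<in> fchain_vs.span B" if "w \<in> fchain_vs.span (Bp p)" for w p
    using that fchain_vs.span_mono[OF BpB] by blast
  have spcyc: "w \<in> fcycles n (?T p)" if "w \<in> fchain_vs.span (Bp p)" for w p
    using fchain_vs.span_minimal[OF _ subspace_fcycles, of "Bp p" n "?T p"] that cyc
    by (auto simp: Bp_def)
  have C: "C p (fclass n (?T p) w) = w" if "p \<in> P" "w \<in> fchain_vs.span (Bp p)" for p w
    unfolding C_def
  proof (rule the_equality)
    fix v assume v: "v \<in> fchain_vs.span (Bp p) \<and> fclass n (?T p) w = fclass n (?T p) v"
    then have "w - v \<in> fboundaries n (?T p)" by (simp add: fclass_eq_iff)
    then have "w - v = 0"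
      using v by (intro uniq[OF that(1), folded Bp_def] fchain_vs.span_diff that(2)) auto
    then show "v = w" by simp
  qed (use that in auto)
  have carr: "\<exists>w \<in> fchain_vs.span (Bp p). A = fclass n (?T p) w"
    if p: "p \<in> P" and A: "A \<in> carrier (fhomology n (?T p))"
    for p and A :: "('a, 'f) fchain set"
  proof -
    obtain z where z: "z \<in> fcycles n (?T p)" "A = fclass n (?T p) z"
      using A by (auto simp: fhomology_carrier)
    with ex[OF p z(1)] show ?thesis
      by (auto simp: fclass_eq_iff Bp_def)
  qed
  have R0: "?R w b = 0" if "w \<in> fchain_vs.span (Bp p)" "p \<notin> I b" for w p b
    using fchain_vs.representation_extend[OF ind that(1) BpB]
      fchain_vs.representation_ne_zero[of "Bp p" w b] that(2) by (auto simp: Bp_def)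
  have hC: "h p (fclass n (?T p) w) = (\<lambda>j\<in>J. ?R w (el j))"
    if "p \<in> P" "w \<in> fchain_vs.span (Bp p)" for p w
    by (simp add: h_def C that)
  have finR: "finite {j\<in>J. ?R w (el j) \<noteq> 0}" for w
  proof (rule finite_subset)
    show "{j\<in>J. ?R w (el j) \<noteq> 0} \<subseteq> (\<lambda>b. (UNIV, {b})) ` {b. ?R w b \<noteq> 0}"
      by (auto simp: J_def)
  qed (simp add: fchain_vs.finite_representation)
  have Ncarr: "x \<in> carrier (pspace N p) \<longleftrightarrow>
      x \<in> extensional J \<and> (\<forall>j\<in>J. p \<notin> I (el j) \<longrightarrow> x j = 0) \<and> finite {j\<in>J. x j \<noteq> 0}" for x p
    by (auto simp: N_def pmod_direct_sum_def interval_module_def PiE_def Pi_iff)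
  have Nadd: "x \<oplus>\<^bsub>pspace N p\<^esub> y = (\<lambda>j\<in>J. x j + y j)"
    and Nsm: "c \<odot>\<^bsub>pspace N p\<^esub> x = (\<lambda>j\<in>J. c * x j)"
    and Nmap: "pmap N p q x = (\<lambda>j\<in>J. if p \<in> I (el j) \<and> q \<in> I (el j) then x j else 0)" for x y p q c
    by (simp_all add: N_def pmod_direct_sum_def interval_module_def)
  have lin: "linear_map (fhomology n (?T p)) (pspace N p) (h p)" if p: "p \<in> P" for p
    unfolding linear_map_def
  proof (intro conjI ballI allI funcsetI)
    fix A :: "('a, 'f) fchain set"
    assume "A \<in> carrier (fhomology n (?T p))"
    then obtain w where w: "w \<in> fchain_vs.span (Bp p)" "A = fclass n (?T p) w"
      using carr[OF p] by blast
    have "{j \<in> J. (if j \<in> J then ?R w (el j) else undefined) \<noteq> 0} = {j\<in>J. ?R w (el j) \<noteq> 0}" by auto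
    then show "h p A \<in> carrier (pspace N p)"
      using R0[OF w(1)] finR[of w] by (auto simp: w(2) hC[OF p w(1)] Ncarr restrict_def extensional_def)
    show "h p (c \<odot>\<^bsub>fhomology n (?T p)\<^esub> A) = c \<odot>\<^bsub>pspace N p\<^esub> h p A" for c
      unfolding w(2) fhomology_smult Nsm hC[OF p w(1)] hC[OF p fchain_vs.span_scale[OF w(1)]]
      by (rule restrict_ext) (simp add: fchain_vs.representation_scale[OF ind spB[OF w(1)]])
    fix A' :: "('a, 'f) fchain set"
    assume "A' \<in> carrier (fhomology n (?T p))"
    then obtain v where v: "v \<in> fchain_vs.span (Bp p)" "A' = fclass n (?T p) v"
      using carr[OF p] by blast
    show "h p (A \<oplus>\<^bsub>fhomology n (?T p)\<^esub> A') = h p A \<oplus>\<^bsub>pspace N p\<^esub> h p A'"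
      unfolding w(2) v(2) fhomology_add Nadd hC[OF p w(1)] hC[OF p v(1)]
        hC[OF p fchain_vs.span_add[OF w(1) v(1)]]
      by (rule restrict_ext) (simp add: fchain_vs.representation_add[OF ind spB[OF v(1)] spB[OF w(1)]])
  qed
  have bij: "bij_betw (h p) (carrier (fhomology n (?T p))) (carrier (pspace N p))" if p: "p \<in> P" for p
    unfolding bij_betw_def
  proof (intro conjI equalityI)
    show "inj_on (h p) (carrier (fhomology n (?T p)))"
    proof (rule inj_onI)
      fix A A' :: "('a, 'f) fchain set"
      assume "A \<in> carrier (fhomology n (?T p))" "A' \<in> carrier (fhomology n (?T p))"
        and eq: "h p A = h p A'"
      then obtain w v where w: "w \<in> fchain_vs.span (Bp p)" "A = fclass n (?T p) w"
        and v: "v \<in> fchain_vs.span (Bp p)" "A' = fclass n (?T p) v"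
        using carr[OF p] by metis
      have "?R w b = ?R v b" if "b \<in> B" for b
        using fun_cong[OF eq[unfolded w(2) v(2) hC[OF p w(1)] hC[OF p v(1)]], of "(UNIV, {b})"] that
        by (simp add: J_def)
      then have "?R w = ?R v"
        using fchain_vs.representation_ne_zero[of B] by (metis ext)
      then have "(\<Sum>b | ?R w b \<noteq> 0. fsmult (?R w b) b) = (\<Sum>b | ?R v b \<noteq> 0. fsmult (?R v b) b)"
        by (simp only:)
      then have "w = v"
        unfolding fchain_vs.sum_nonzero_representation_eq[OF ind spB[OF w(1)]]
          fchain_vs.sum_nonzero_representation_eq[OF ind spB[OF v(1)]] .
      then show "A = A'" by (simp add: w v)
    qed
    show "h p ` carrier (fhomology n (?T p)) \<subseteq> carrier (pspace N p)"
      using lin[OF p] by (auto simp: linear_map_def)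
    show "carrier (pspace N p) \<subseteq> h p ` carrier (fhomology n (?T p))"
    proof
      fix x assume x: "x \<in> carrier (pspace N p)"
      define f where "f b = (if b \<in> B then x (UNIV, {b}) else 0)" for b
      define w where "w = (\<Sum>b | f b \<noteq> 0. fsmult (f b) b)"
      have fBp: "b \<in> Bp p" if "f b \<noteq> 0" for b
        using that x by (auto simp: f_def Ncarr Bp_def J_def split: if_splits)
      have "{b. f b \<noteq> 0} \<subseteq> el ` {j\<in>J. x j \<noteq> 0}"
      proof
        fix b assume "b \<in> {b. f b \<noteq> 0}"
        then show "b \<in> el ` {j\<in>J. x j \<noteq> 0}"
          by (intro image_eqI[of _ _ "(UNIV, {b})"]) (auto simp: f_def J_def split: if_splits)
      qed
      then have fin: "finite {b. f b \<noteq> 0}"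
        using x by (auto simp: Ncarr dest: finite_subset)
      have w: "w \<in> fchain_vs.span (Bp p)"
        unfolding w_def using fBp
        by (auto intro!: fchain_vs.span_sum fchain_vs.span_scale intro: fchain_vs.span_base)
      have R: "?R w = f"
        by (rule fchain_vs.representation_eqI[OF ind spB[OF w]])
           (use fin fBp BpB in \<open>auto simp: w_def\<close>)
      have "h p (fclass n (?T p) w) = x"
        unfolding hC[OF p w] R using x
        by (auto simp: Ncarr extensional_def fun_eq_iff restrict_def f_def J_def)
      then show "x \<in> h p ` carrier (fhomology n (?T p))"
        using spcyc[OF w] by (auto simp: fhomology_carrier)
    qed
  qed
  have nat: "h q (fhomology_map n (?T q) (\<lambda>z. z) A) = pmap N p q (h p A)"
    if p: "p \<in> P" and q: "q \<in> P" and pq: "ple p q" and A: "A \<in> carrier (fhomology n (?T p))"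
    for p q and A :: "('a, 'f) fchain set"
  proof -
    obtain w where w: "w \<in> fchain_vs.span (Bp p)" "A = fclass n (?T p) w"
      using carr[OF p A] by blast
    \<comment> \<open>What is alive at \<open>p\<close> is alive at \<open>q\<close>, so
      \<open>w\<close> is also the canonical representative of the image. Coordinates that become
      alive only between \<open>p\<close> and \<open>q\<close> are zero on both sides.\<close>
    have "Bp p \<subseteq> Bp q" using up q pq by (auto simp: Bp_def)
    then have wq: "w \<in> fchain_vs.span (Bp q)" using w(1) fchain_vs.span_mono by blast
    show ?thesis
      unfolding w(2) fhomology_map_class[OF mono[OF p q pq] spcyc[OF w(1)]] hC[OF q wq] hC[OF p w(1)] Nmap
      by (rule restrict_ext) (use R0[OF w(1)] up[OF elJ _ q pq] in auto)
  qed
  have "pmod_isomorphic P ple (filtration_PH n S) N"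
    unfolding pmod_isomorphic_def filtration_PH_def
    by (intro exI[of _ h]) (use lin bij nat in auto)
  moreover have "\<forall>j\<in>J. poset_interval P ple (I (el j))"
    using int elJ by blast
  ultimately show ?thesis
    unfolding interval_decomposable_def N_def
    by (intro exI[of _ J] exI[of _ "\<lambda>j. I (el j)"] conjI)
qed

section \<open>Bases of quotients by chosen representatives\<close>

context vector_space
begin

lemma independent_Un_of_span_inter:
  assumes A: "independent A" and B: "independent B" and AB: "span A \<inter> span B \<subseteq> {0}"
  shows "independent (A \<union> B)"
  unfolding independent_explicit_module
proof (intro allI impI)
  fix t u v
  assume t: "finite t" "t \<subseteq> A \<union> B" and sum: "(\<Sum>v\<in>t. scale (u v) v) = 0" and v: "v \<in> t"
  let ?a = "\<Sum>v\<in>t \<inter> A. scale (u v) v" and ?b = "\<Sum>v\<in>t - A. scale (u v) v"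
  have "?a + ?b = 0"
    using sum sum.Int_Diff[OF t(1), of "\<lambda>v. scale (u v) v" A] by simp
  then have ab: "?a = - ?b" by (simp add: eq_neg_iff_add_eq_0)
  have a: "?a \<in> span A" by (auto intro!: span_sum span_scale intro: span_base)
  have b: "?b \<in> span B" using t by (auto intro!: span_sum span_scale intro: span_base)
  have "?a = 0" using a span_neg[OF b] AB unfolding ab by blast
  moreover from this have "?b = 0" using ab by simp
  ultimately show "u v = 0"
    using v t A[unfolded independent_explicit_module, rule_format, of "t \<inter> A" u v]
      B[unfolded independent_explicit_module, rule_format, of "t - A" u v] by blast
qed

text \<open>The coordinates of \<open>w\<close> with respect to the union are supported in
  \<open>A\<close> and in \<open>B\<close> at once, hence nowhere.\<close>

lemma span_inter_of_independent_Un: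
  assumes "independent (A \<union> B)" "A \<inter> B = {}" "w \<in> span A" "w \<in> span B"
  shows "w = 0"
proof -
  have "representation A w = representation B w"
    using representation_extend[OF assms(1) assms(3)] representation_extend[OF assms(1) assms(4)] by simp
  then have "representation A w b = 0" for b
    using representation_ne_zero[of A w b] representation_ne_zero[of B w b] assms(2) by auto
  moreover have "independent A" using assms(1) by (rule independent_mono) simp
  ultimately show ?thesis
    using sum_nonzero_representation_eq[of A w] assms(3) by simp
qed

text \<open>\<open>B\<close> represents a basis of \<open>Z\<close>/\<open>N\<close> that contains
  \<open>B'\<close>. Adjoin to \<open>B'\<close> a basis of \<open>N\<close>, complete the union to
  a basis of \<open>Z\<close>, and discard the part from \<open>N\<close> again.\<close>

lemma extend_to_complement_basis:
  assumes Z: "subspace Z" and N: "subspace N" "N \<subseteq> Z"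
    and B': "independent B'" "B' \<subseteq> Z" "span B' \<inter> N \<subseteq> {0}"
  obtains B where "B' \<subseteq> B" "B \<subseteq> Z" "independent B" "span B \<inter> N \<subseteq> {0}"
    "\<forall>z\<in>Z. \<exists>w\<in>span B. z - w \<in> N"
proof -
  obtain b where b: "b \<subseteq> N" "independent b" "N \<subseteq> span b"
    using maximal_independent_subset by blast
  then have sb: "span b = N" using span_minimal[OF b(1) N(1)] by blast
  have "independent (B' \<union> b)"
    using independent_Un_of_span_inter[OF B'(1) b(2)] B'(3) sb by simp
  then obtain M where M: "B' \<union> b \<subseteq> M" "M \<subseteq> Z" "independent M" "Z \<subseteq> span M"
    using maximal_independent_subset_extend[of "B' \<union> b" Z] B'(2) b(1) N(2) by blast
  have M': "M = (M - b) \<union> b" using M(1) by blast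
  \<comment> \<open>A common element would be a nonzero vector of \<open>span B' \<inter> N\<close>.
    Disjointness is what keeps \<open>B'\<close> when \<open>b\<close> is removed.\<close>
  have "0 \<notin> B'" using B'(1) dependent_zero by blast
  then have disj: "B' \<inter> b = {}" using B'(3) b(1) span_superset[of B'] by blast
  show thesis
  proof (rule that)
    show "B' \<subseteq> M - b" using M(1) disj by blast
    show "M - b \<subseteq> Z" using M(2) by blast
    show "independent (M - b)" using M(3) by (rule independent_mono) blast
    show "span (M - b) \<inter> N \<subseteq> {0}"
      using span_inter_of_independent_Un[of "M - b" b] M(3) M' sb by auto
    show "\<forall>z\<in>Z. \<exists>w\<in>span (M - b). z - w \<in> N"
    proof
      fix z assume "z \<in> Z"
      then have "z \<in> span ((M - b) \<union> b)" using M(4) M' by auto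
      then obtain x y where "z = x + y" "x \<in> span (M - b)" "y \<in> span b"
        unfolding span_Un by blast
      then show "\<exists>w\<in>span (M - b). z - w \<in> N" using sb by (intro bexI[of _ x]) auto
    qed
  qed
qed

text \<open>The hypothesis \<open>inter\<close> says that \<open>Z'\<close>/\<open>N'\<close> maps
  injectively to \<open>Z\<close>/\<open>N\<close>. Representatives of a basis of the former thus
  stay independent modulo \<open>N\<close> and can be completed to representatives of a basis of the
  latter.\<close>

lemma adapted_complement_bases:
  assumes "subspace Z" "subspace N" "N \<subseteq> Z" "subspace Z'" "subspace N'" "N' \<subseteq> Z'" "Z' \<subseteq> Z"
    and inter: "Z' \<inter> N \<subseteq> N'"
  obtains B' B where "B' \<subseteq> B" "independent B" "B' \<subseteq> Z'" "B \<subseteq> Z"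
    "span B' \<inter> N' \<subseteq> {0}" "\<forall>z\<in>Z'. \<exists>w\<in>span B'. z - w \<in> N'"
    "span B \<inter> N \<subseteq> {0}" "\<forall>z\<in>Z. \<exists>w\<in>span B. z - w \<in> N"
proof -
  have e: "independent {}" "{} \<subseteq> Z'" "span {} \<inter> N' \<subseteq> {0}"
    by (simp_all add: independent_empty)
  obtain B' where B': "{} \<subseteq> B'" "B' \<subseteq> Z'" "independent B'" "span B' \<inter> N' \<subseteq> {0}"
    "\<forall>z\<in>Z'. \<exists>w\<in>span B'. z - w \<in> N'"
    by (rule extend_to_complement_basis[OF assms(4-6) e])
  have "span B' \<subseteq> Z'" using B'(2) assms(4) by (rule span_minimal)
  then have int: "span B' \<inter> N \<subseteq> {0}" using inter B'(4) by blast
  have "B' \<subseteq> Z" using B'(2) assms(7) by blast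
  then obtain B where B: "B' \<subseteq> B" "B \<subseteq> Z" "independent B" "span B \<inter> N \<subseteq> {0}"
    "\<forall>z\<in>Z. \<exists>w\<in>span B. z - w \<in> N"
    by (rule extend_to_complement_basis[OF assms(1-3) B'(3) _ int])
  show thesis
    by (rule that[OF B(1) B(3) B'(2) B(2) B'(4) B'(5) B(4) B(5)])
qed

end

section \<open>Homology of a space that deforms onto a subspace\<close>

text \<open>A deformation retraction in the weak sense: points of \<open>Z\<close> are required to
  be fixed at time 1 only.\<close>

locale deformation =
  fixes S Z :: "'a::topological_space set" and h :: "real \<times> 'a \<Rightarrow> 'a"
  assumes homotopy: "continuous_map (prod_topology (top_of_set {0..1}) (top_of_set S)) (top_of_set S) h"
    and start: "\<And>x. x \<in> S \<Longrightarrow> h (0, x) = x"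
    and finish: "\<And>x. x \<in> S \<Longrightarrow> h (1, x) \<in> Z"
    and fixed: "\<And>x. x \<in> Z \<Longrightarrow> h (1, x) = x"
    and subset: "Z \<subseteq> S"
begin

lemma continuous_retraction: "continuous_map (top_of_set S) (top_of_set Z) (\<lambda>x. h (1, x))"
proof -
  have "continuous_map (top_of_set S) (prod_topology (top_of_set {0..1}) (top_of_set S)) (\<lambda>x. (1::real, x))"
    by (auto intro!: continuous_intros)
  from continuous_map_compose[OF this homotopy] show ?thesis
    using finish by (auto simp: o_def)
qed

text \<open>This is surjectivity of the map on first homology induced by the inclusion of
  \<open>Z\<close>: the prism operator joins a cycle to its image under the retraction.\<close>

lemma fcycle_homologous:
  assumes "z \<in> fcycles 1 (top_of_set S)"
  shows "fchain_map 1 (\<lambda>x. h (1, x)) z \<in> fcycles 1 (top_of_set Z)"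
    and "z - fchain_map 1 (\<lambda>x. h (1, x)) z \<in> fboundaries 1 (top_of_set S)"
proof -
  show "fchain_map 1 (\<lambda>x. h (1, x)) z \<in> fcycles 1 (top_of_set Z)"
    using fchain_map_in_fcycles[OF assms[unfolded One_nat_def] continuous_retraction] by simp
  have "fchain_map 1 (\<lambda>x. h (0, x)) z = z"
    by (rule fchain_map_eq_self[of _ _ "top_of_set S"]) (use assms start in \<open>auto simp: fcycles_def\<close>)
  then show "z - fchain_map 1 (\<lambda>x. h (1, x)) z \<in> fboundaries 1 (top_of_set S)"
    using fboundaries_diff[OF fboundaries_closed(1) homotopy_fchain_map_diff[OF homotopy assms]]
    by simp
qed

text \<open>This is injectivity: the retraction carries a bounding chain into \<open>Z\<close> and
  does not change \<open>z\<close>.\<close>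

lemma fboundaries_reflect:
  assumes "z \<in> fchains p (top_of_set Z)" "z \<in> fboundaries p (top_of_set S)"
  shows "z \<in> fboundaries p (top_of_set Z)"
proof -
  have "fchain_map p (\<lambda>x. h (1, x)) z = z"
    by (rule fchain_map_eq_self[OF assms(1)]) (use fixed in auto)
  then show ?thesis
    using fchain_map_in_fboundaries[OF assms(2) continuous_retraction] by simp
qed

end

lemma fboundaries_mono:
  "S \<subseteq> T \<Longrightarrow> fboundaries p (top_of_set S) \<subseteq> fboundaries p (top_of_set T)"
  unfolding fboundaries_def using fchains_mono by blast

section \<open>Points of the star graph\<close>

lemma star_graph_iff:
  assumes "k \<ge> 1"
  shows "x \<in> star_graph k \<longleftrightarrow> (\<forall>i. 0 \<le> x i \<and> x i \<le> 1) \<and> (\<forall>i. x i \<noteq> 0 \<longrightarrow> i \<in> {1..k}) \<and>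
    (\<forall>i j. x i \<noteq> 0 \<longrightarrow> x j \<noteq> 0 \<longrightarrow> i = j)" (is "_ \<longleftrightarrow> ?R")
proof
  assume "x \<in> star_graph k"
  then show ?R by (auto simp: star_graph_def star_point_def split: if_splits)
next
  assume R: ?R
  show "x \<in> star_graph k"
  proof (cases "\<exists>i. x i \<noteq> 0")
    case True
    then obtain i where i: "x i \<noteq> 0" by blast
    then have "x = star_point i (x i)" using R by (auto simp: star_point_def fun_eq_iff)
    then show ?thesis using R i by (auto simp: star_graph_def)
  next
    case False
    then have "x = star_point 1 0" by (auto simp: star_point_def fun_eq_iff)
    then show ?thesis using assms star_point_in[of 1 k 0] by simp
  qed
qed

lemma star_graph_bounds:
  assumes "x \<in> star_graph k"
  shows "0 \<le> x i" "x i \<le> 1"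
  using assms by (auto simp: star_graph_def star_point_def)

lemma star_graph_support:
  assumes "x \<in> star_graph k"
  shows "x i \<noteq> 0 \<Longrightarrow> i \<in> {1..k}" "x i \<noteq> 0 \<Longrightarrow> x j \<noteq> 0 \<Longrightarrow> i = j"
  using assms by (auto simp: star_graph_def star_point_def split: if_splits)

text \<open>If the support does not grow, the point stays on its edge. Straight line homotopies are
  kept in the graph this way, without naming the edge.\<close>

lemma star_graph_shrink:
  assumes "x \<in> star_graph k" "\<And>i. 0 \<le> y i \<and> y i \<le> 1" "\<And>i. x i = 0 \<Longrightarrow> y i = 0"
  shows "y \<in> star_graph k"
proof -
  have "k \<ge> 1" using assms(1) by (auto simp: star_graph_def)
  then show ?thesis
    using assms star_graph_support[OF assms(1)] by (subst star_graph_iff) metis+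
qed

lemma sum_star_graph_le_1:
  assumes "x \<in> star_graph k" "finite T"
  shows "(\<Sum>i\<in>T. x i) \<le> 1"
proof -
  obtain i t where x: "x = star_point i t" "0 \<le> t" "t \<le> 1"
    using assms(1) by (auto simp: star_graph_def)
  show ?thesis using assms(2) x by (simp add: star_point_def sum.delta)
qed

lemma star_conf_iff:
  assumes "L > 0"
  shows "(x, y) \<in> star_conf k r L \<longleftrightarrow> x \<in> star_graph k \<and> y \<in> star_graph k \<and>
    r \<le> (\<Sum>i=1..k. edge_length L i * \<bar>x i - y i\<bar>)"
  using assms by (auto simp: star_conf_def star_dist_eq)

lemma continuous_on_fst_coordinate [continuous_intros]:
  "continuous_on S g \<Longrightarrow> continuous_on S (\<lambda>p. fst (g p) (i::nat) :: real)"
  by (rule continuous_on_product_then_coordinatewise) (rule continuous_on_fst)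

lemma continuous_on_snd_coordinate [continuous_intros]:
  "continuous_on S g \<Longrightarrow> continuous_on S (\<lambda>p. snd (g p) (i::nat) :: real)"
  by (rule continuous_on_product_then_coordinatewise) (rule continuous_on_snd)

definition straight ::
    "('a \<Rightarrow> (nat \<Rightarrow> real) \<times> (nat \<Rightarrow> real)) \<Rightarrow> ('a \<Rightarrow> (nat \<Rightarrow> real) \<times> (nat \<Rightarrow> real)) \<Rightarrow>
      real \<times> 'a \<Rightarrow> (nat \<Rightarrow> real) \<times> (nat \<Rightarrow> real)" where
  "straight f g = (\<lambda>(u, p). (\<lambda>i. (1 - u) * fst (f p) i + u * fst (g p) i,
                             \<lambda>i. (1 - u) * snd (f p) i + u * snd (g p) i))"

lemma straight_0 [simp]: "straight f g (0, p) = f p"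
  and straight_1 [simp]: "straight f g (1, p) = g p"
  by (simp_all add: straight_def)

lemma continuous_on_straight:
  assumes "continuous_on S f" "continuous_on S g"
  shows "continuous_on ({0..1} \<times> S) (straight f g)"
proof -
  have c: "continuous_on ({0..1} \<times> S) (\<lambda>q. g (snd q))" if "continuous_on S g" 
    for g :: "'a \<Rightarrow> (nat \<Rightarrow> real) \<times> (nat \<Rightarrow> real)"
    by (rule continuous_on_compose2[OF that]) (auto intro: continuous_intros)
  show ?thesis
    unfolding straight_def case_prod_beta
    by (intro continuous_on_Pair continuous_on_coordinatewise_then_product continuous_intros
        c assms)
qed

section \<open>The cone coordinates of a configuration\<close>

text \<open>On coordinates this is \<open>x i - min (x i) (y i)\<close>, what is left of
  \<open>x\<close> after removing the part common to both points.\<close>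

definition excess :: "(nat \<Rightarrow> real) \<Rightarrow> (nat \<Rightarrow> real) \<Rightarrow> nat \<Rightarrow> real" where
  "excess x y i = max 0 (x i - y i)"

text \<open>A point of the graph has at most one nonzero coordinate, so each sum is the parameter of
  what remains of one point on the edges in \<open>T\<close>. Dividing by the larger one moves that
  point to a leaf.\<close>

definition spread :: "nat set \<Rightarrow> (nat \<Rightarrow> real) \<times> (nat \<Rightarrow> real) \<Rightarrow> real" where
  "spread T = (\<lambda>(x, y). max (\<Sum>i\<in>T. excess x y i) (\<Sum>i\<in>T. excess y x i))"

definition project ::
    "nat set \<Rightarrow> (nat \<Rightarrow> real) \<times> (nat \<Rightarrow> real) \<Rightarrow> (nat \<Rightarrow> real) \<times> (nat \<Rightarrow> real)" where
  "project T = (\<lambda>(x, y). (\<lambda>i. if i \<in> T then excess x y i / spread T (x, y) else 0,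
                          \<lambda>i. if i \<in> T then excess y x i / spread T (x, y) else 0))"

text \<open>The graph with vertices (leaf of i, centre) and (centre, leaf of j) for i, j in
  \<open>T\<close>, and one edge for each pair of distinct i and j, running through the corner (leaf
  of i, leaf of j).\<close>

definition star_skeleton :: "nat \<Rightarrow> nat set \<Rightarrow> ((nat \<Rightarrow> real) \<times> (nat \<Rightarrow> real)) set" where
  "star_skeleton k T = {(x, y). x \<in> star_graph k \<and> y \<in> star_graph k \<and>
     (\<forall>i. i \<notin> T \<longrightarrow> x i = 0 \<and> y i = 0) \<and> (\<forall>i. x i = 0 \<or> y i = 0) \<and>
     max (\<Sum>i\<in>T. x i) (\<Sum>i\<in>T. y i) = 1}"

lemma excess_simps:
  "0 \<le> excess x y i" "excess x y i - excess y x i = x i - y i" "excess x y i \<le> \<bar>x i - y i\<bar>"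
  "excess x y i = 0 \<or> excess y x i = 0" "x i \<noteq> y i \<Longrightarrow> 0 < excess x y i \<or> 0 < excess y x i"
  by (auto simp: excess_def)

lemma spread_pos:
  assumes "finite T" "i \<in> T" "x i \<noteq> y i"
  shows "0 < spread T (x, y)"
proof -
  have "0 < (\<Sum>i\<in>T. excess x y i) \<or> 0 < (\<Sum>i\<in>T. excess y x i)"
    using assms excess_simps(1,5) by (metis sum_pos2)
  then show ?thesis by (auto simp: spread_def)
qed

lemma excess_le_spread:
  assumes "finite T" "i \<in> T"
  shows "excess x y i \<le> spread T (x, y)" "excess y x i \<le> spread T (x, y)"
  using assms member_le_sum[of i T "excess x y"] member_le_sum[of i T "excess y x"]
  by (auto simp: spread_def excess_simps(1) le_max_iff_disj)

lemma spread_le: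
  assumes "finite T"
  shows "spread T (x, y) \<le> (\<Sum>i\<in>T. \<bar>x i - y i\<bar>)"
  unfolding spread_def using excess_simps(3)[of x y] excess_simps(3)[of y x]
  by (auto intro!: sum_mono simp: abs_minus_commute)

lemma continuous_on_spread: "finite T \<Longrightarrow> continuous_on S (spread T)"
  unfolding spread_def excess_def case_prod_beta
  by (intro continuous_intros continuous_on_max)

lemma continuous_on_project:
  assumes "finite T" "\<And>p. p \<in> S \<Longrightarrow> spread T p \<noteq> 0"
  shows "continuous_on S (project T)"
proof -
  have "continuous_on S (\<lambda>p. if i \<in> T then excess (fst p) (snd p) i / spread T p else 0)"
    "continuous_on S (\<lambda>p. if i \<in> T then excess (snd p) (fst p) i / spread T p else 0)" for i
    using assms by (cases "i \<in> T"; auto simp: excess_def intro!: continuous_intros continuous_on_spread)+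
  then show ?thesis
    unfolding project_def case_prod_beta
    unfolding prod.collapse
    by (intro continuous_on_Pair continuous_on_coordinatewise_then_product)
qed

lemma project_coordinate_bounds:
  assumes "finite T" "spread T (x, y) > 0"
  shows "0 \<le> fst (project T (x, y)) i" "fst (project T (x, y)) i \<le> 1"
    "0 \<le> snd (project T (x, y)) i" "snd (project T (x, y)) i \<le> 1"
  using assms excess_le_spread[OF assms(1), of i, where x = x and y = y]
  by (auto simp: project_def excess_simps)

lemma project_coordinate_zero:
  assumes "x \<in> star_graph k" "y \<in> star_graph k"
  shows "x i = 0 \<Longrightarrow> fst (project T (x, y)) i = 0" "y i = 0 \<Longrightarrow> snd (project T (x, y)) i = 0"
  using star_graph_bounds[OF assms(1), of i] star_graph_bounds[OF assms(2), of i]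
  by (auto simp: project_def excess_def)

lemma project_in_skeleton:
  assumes "x \<in> star_graph k" "y \<in> star_graph k" "finite T" "spread T (x, y) > 0"
  shows "project T (x, y) \<in> star_skeleton k T"
proof -
  note b = project_coordinate_bounds[OF assms(3,4)] and z = project_coordinate_zero[OF assms(1,2)]
  have g: "fst (project T (x, y)) \<in> star_graph k" "snd (project T (x, y)) \<in> star_graph k"
    by (rule star_graph_shrink[OF assms(1)] star_graph_shrink[OF assms(2)]; use b z in blast)+
  have s: "(\<Sum>i\<in>T. fst (project T (x, y)) i) = (\<Sum>i\<in>T. excess x y i) / spread T (x, y)"
    "(\<Sum>i\<in>T. snd (project T (x, y)) i) = (\<Sum>i\<in>T. excess y x i) / spread T (x, y)"
    by (simp_all add: project_def sum_divide_distrib)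
  have "max (\<Sum>i\<in>T. fst (project T (x, y)) i) (\<Sum>i\<in>T. snd (project T (x, y)) i) = 1"
    using assms(4) unfolding s by (auto simp: spread_def max_def field_simps split: if_splits)
  moreover have "i \<notin> T \<longrightarrow> fst (project T (x, y)) i = 0 \<and> snd (project T (x, y)) i = 0"
    "fst (project T (x, y)) i = 0 \<or> snd (project T (x, y)) i = 0" for i
    using excess_simps(4)[of x y i] by (auto simp: project_def)
  ultimately show ?thesis
    using g by (simp add: star_skeleton_def case_prod_beta)
qed

lemma project_skeleton:
  assumes "p \<in> star_skeleton k T"
  shows "project T p = p"
proof -
  obtain x y where p: "p = (x, y)" by (cases p)
  with assms have g: "x \<in> star_graph k" "y \<in> star_graph k"
    and T: "\<And>i. i \<notin> T \<Longrightarrow> x i = 0 \<and> y i = 0" and d: "\<And>i. x i = 0 \<or> y i = 0"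
    and m: "max (\<Sum>i\<in>T. x i) (\<Sum>i\<in>T. y i) = 1"
    by (auto simp: star_skeleton_def)
  have e: "excess x y i = x i" "excess y x i = y i" for i
    using d[of i] star_graph_bounds[OF g(1), of i] star_graph_bounds[OF g(2), of i]
    by (auto simp: excess_def)
  show ?thesis
    using T m by (auto simp: p project_def spread_def e)
qed

text \<open>Along the straight line to the projection every coordinate of \<open>x - y\<close> keeps its sign, so that
  the distance is an affine function of the parameter.\<close>

lemma deformation_star_conf:
  assumes r: "r > 0" "L > 0" and T: "T \<subseteq> {1..k}" and short: "\<And>i. i \<in> T \<Longrightarrow> r \<le> edge_length L i"
    and differ: "\<And>x y. (x, y) \<in> star_conf k r L \<Longrightarrow> \<exists>i\<in>T. x i \<noteq> y i"
  shows "deformation (star_conf k r L) (star_skeleton k T) (straight id (project T))"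
proof
  have fT: "finite T" using T by (rule finite_subset) simp
  have weight: "r * (\<Sum>i\<in>T. \<bar>x i - y i\<bar>) \<le> (\<Sum>i\<in>T. edge_length L i * \<bar>x i - y i\<bar>)"
    for x y :: "nat \<Rightarrow> real"
    using short by (auto simp: sum_distrib_left intro!: sum_mono mult_right_mono)
  have pos: "0 < spread T (x, y)" if "(x, y) \<in> star_conf k r L" for x y
    using differ[OF that] spread_pos[OF fT] by blast
  have inside: "straight id (project T) (u, (x, y)) \<in> star_conf k r L"
    if xy: "(x, y) \<in> star_conf k r L" and u: "0 \<le> u" "u \<le> 1" for x y u
  proof -
    have g: "x \<in> star_graph k" "y \<in> star_graph k"
      and d: "r \<le> (\<Sum>i=1..k. edge_length L i * \<bar>x i - y i\<bar>)"
      using xy r by (auto simp: star_conf_iff)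
    let ?N = "spread T (x, y)"
    note N = pos[OF xy]
    note b = project_coordinate_bounds[OF fT N] and z = project_coordinate_zero[OF g]
    define x' y' where "x' = (\<lambda>i. (1 - u) * x i + u * fst (project T (x, y)) i)"
      and "y' = (\<lambda>i. (1 - u) * y i + u * snd (project T (x, y)) i)"
    have cv: "(1 - u) * s + u * t \<le> 1" if "s \<le> 1" "t \<le> 1" for s t :: real
      using convex_bound_le[OF that, of "1 - u" u] u by simp
    have x': "x' \<in> star_graph k"
      by (rule star_graph_shrink[OF g(1)])
         (use b z u star_graph_bounds[OF g(1)] in \<open>auto simp: x'_def intro!: cv\<close>)
    have y': "y' \<in> star_graph k"
      by (rule star_graph_shrink[OF g(2)])
         (use b z u star_graph_bounds[OF g(2)] in \<open>auto simp: y'_def intro!: cv\<close>)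
    have "\<bar>x' i - y' i\<bar> = (1 - u) * \<bar>x i - y i\<bar> + (if i \<in> T then u / ?N * \<bar>x i - y i\<bar> else 0)" for i
    proof -
      \<comment> \<open>Removing the common part does not change the difference, so on
        \<open>T\<close> projecting merely divides \<open>x - y\<close> by the spread. Along the
        line each coordinate of the difference is multiplied by a nonnegative factor.\<close>
      have "fst (project T (x, y)) i - snd (project T (x, y)) i = (if i \<in> T then (x i - y i) / ?N else 0)"
        using excess_simps(2)[of x y i] by (simp add: project_def flip: diff_divide_distrib)
      moreover have "x' i - y' i = (1 - u) * (x i - y i)
          + u * (fst (project T (x, y)) i - snd (project T (x, y)) i)"
        by (simp add: x'_def y'_def right_diff_distrib)
      ultimately have "x' i - y' i = (x i - y i) * ((1 - u) + (if i \<in> T then u / ?N else 0))"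
        by (simp add: distrib_left mult.commute)
      moreover have "0 \<le> (1 - u) + (if i \<in> T then u / ?N else 0)" using u N by auto
      ultimately have "\<bar>x' i - y' i\<bar> = \<bar>x i - y i\<bar> * ((1 - u) + (if i \<in> T then u / ?N else 0))"
        by (simp only: abs_mult abs_of_nonneg)
      then show ?thesis by (cases "i \<in> T") (simp_all add: distrib_left mult.commute)
    qed
    then have "edge_length L i * \<bar>x' i - y' i\<bar> = (1 - u) * (edge_length L i * \<bar>x i - y i\<bar>)
        + (if i \<in> T then u / ?N * (edge_length L i * \<bar>x i - y i\<bar>) else 0)" for i
      by (cases "i \<in> T") (simp_all add: distrib_left mult.left_commute)
    then have "(\<Sum>i=1..k. edge_length L i * \<bar>x' i - y' i\<bar>)
        = (1 - u) * (\<Sum>i=1..k. edge_length L i * \<bar>x i - y i\<bar>)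
          + (\<Sum>i=1..k. if i \<in> T then u / ?N * (edge_length L i * \<bar>x i - y i\<bar>) else 0)"
      by (simp only: sum.distrib sum_distrib_left)
    also have "(\<Sum>i=1..k. if i \<in> T then u / ?N * (edge_length L i * \<bar>x i - y i\<bar>) else 0)
        = u / ?N * (\<Sum>i\<in>T. edge_length L i * \<bar>x i - y i\<bar>)"
      using T by (simp add: sum_distrib_left sum.inter_restrict[symmetric] Int_absorb1)
    finally have eq: "(\<Sum>i=1..k. edge_length L i * \<bar>x' i - y' i\<bar>)
        = (1 - u) * (\<Sum>i=1..k. edge_length L i * \<bar>x i - y i\<bar>)
          + u / ?N * (\<Sum>i\<in>T. edge_length L i * \<bar>x i - y i\<bar>)" .
    \<comment> \<open>The bound at the far end: the spread is at most the unweighted difference over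
      \<open>T\<close>, and every edge in \<open>T\<close> has length at least \<open>r\<close>.
      Together with the bound at the start this gives \<open>(1 - u) * r + u * r\<close>.\<close>
    have "r * ?N \<le> (\<Sum>i\<in>T. edge_length L i * \<bar>x i - y i\<bar>)"
      by (rule order_trans[OF mult_left_mono[OF spread_le[OF fT]] weight]) (use r in simp)
    then have "u / ?N * (r * ?N) \<le> u / ?N * (\<Sum>i\<in>T. edge_length L i * \<bar>x i - y i\<bar>)"
      by (rule mult_left_mono) (use u N in simp)
    moreover have "u / ?N * (r * ?N) = u * r" using N by simp
    moreover have "(1 - u) * r \<le> (1 - u) * (\<Sum>i=1..k. edge_length L i * \<bar>x i - y i\<bar>)"
      by (rule mult_left_mono[OF d]) (use u in simp)
    moreover have "(1 - u) * r + u * r = r" by (simp add: left_diff_distrib)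
    ultimately have "r \<le> (\<Sum>i=1..k. edge_length L i * \<bar>x' i - y' i\<bar>)"
      unfolding eq by linarith
    then show ?thesis
      using x' y' r by (simp add: straight_def star_conf_iff x'_def y'_def)
  qed
  have "continuous_on ({0..1} \<times> star_conf k r L) (straight id (project T))"
    by (intro continuous_on_straight continuous_on_project continuous_on_id' fT)
       (use pos in \<open>auto simp: id_def less_imp_neq[symmetric]\<close>)
  then show "continuous_map (prod_topology (top_of_set {0..1}) (top_of_set (star_conf k r L)))
      (top_of_set (star_conf k r L)) (straight id (project T))"
    using inside by auto
  show "straight id (project T) (1, p) \<in> star_skeleton k T" if "p \<in> star_conf k r L" for p
    using that r pos project_in_skeleton[OF _ _ fT] by (cases p) (auto simp: star_conf_iff)
  show "straight id (project T) (1, p) = p" if "p \<in> star_skeleton k T" for p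
    using project_skeleton[OF that] by simp
  show "star_skeleton k T \<subseteq> star_conf k r L"
  proof clarify
    fix x y assume xy: "(x, y) \<in> star_skeleton k T"
    then have g: "x \<in> star_graph k" "y \<in> star_graph k"
      and m: "max (\<Sum>i\<in>T. x i) (\<Sum>i\<in>T. y i) = 1" and d: "\<And>i. x i = 0 \<or> y i = 0"
      by (auto simp: star_skeleton_def)
    \<comment> \<open>The supports are disjoint, so nothing cancels, and the point at a leaf alone
      contributes a full edge of \<open>T\<close>.\<close>
    have "x i \<le> \<bar>x i - y i\<bar>" "y i \<le> \<bar>x i - y i\<bar>" for i
      using d[of i] star_graph_bounds[OF g(1), of i] star_graph_bounds[OF g(2), of i] by auto
    then have "(\<Sum>i\<in>T. x i) \<le> (\<Sum>i\<in>T. \<bar>x i - y i\<bar>)" "(\<Sum>i\<in>T. y i) \<le> (\<Sum>i\<in>T. \<bar>x i - y i\<bar>)"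
      by (auto intro!: sum_mono)
    then have "r * 1 \<le> r * (\<Sum>i\<in>T. \<bar>x i - y i\<bar>)" using m r by (intro mult_left_mono) auto
    also have "\<dots> \<le> (\<Sum>i\<in>T. edge_length L i * \<bar>x i - y i\<bar>)" by (rule weight)
    also have "\<dots> \<le> (\<Sum>i=1..k. edge_length L i * \<bar>x i - y i\<bar>)"
      using T r by (intro sum_mono2) (auto simp: edge_length_def)
    finally show "(x, y) \<in> star_conf k r L" using g r by (simp add: star_conf_iff)
  qed
qed simp

section \<open>Distances above 1: no first homology\<close>

lemma continuous_on_finite_closed_cover:
  fixes f :: "'a::topological_space \<Rightarrow> 'b::topological_space"
  assumes "finite I" "\<And>i. i \<in> I \<Longrightarrow> closed (T i)" "S \<subseteq> (\<Union>i\<in>I. T i)"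
    and "\<And>i. i \<in> I \<Longrightarrow> continuous_on (S \<inter> T i) f"
  shows "continuous_on S f"
proof -
  have "continuous_map (top_of_set S) euclidean f"
  proof (rule pasting_lemma_closed[OF assms(1), where T = "\<lambda>i. S \<inter> T i" and f = "\<lambda>_. f"])
    show "closedin (top_of_set S) (S \<inter> T i)" if "i \<in> I" for i
      by (rule closedin_closed_Int[OF assms(2)[OF that]])
    show "continuous_map (subtopology (top_of_set S) (S \<inter> T i)) euclidean f" if "i \<in> I" for i
      using assms(4)[OF that] by (simp add: subtopology_subtopology)
    show "\<exists>j. j \<in> I \<and> x \<in> S \<inter> T j \<and> f x = f x" if "x \<in> topspace (top_of_set S)" for x
      using that assms(3) by auto
  qed auto
  then show ?thesis by simp
qed

text \<open>If the two points are farther apart than every edge except possibly \<open>e\<^sub>1\<close> is long, each component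
  of the configuration space can be pushed straight to a single configuration: to one point at the
  leaf of \<open>e\<^sub>1\<close> and the other at the centre if their distance along \<open>e\<^sub>1\<close> suffices, and to a pair of
  leaves otherwise.\<close>

lemma star_conf_far:
  assumes r: "r > 1" and L: "L > 0" and k: "k \<ge> 1"
  shows "fcycles 1 (top_of_set (star_conf k r L))
    \<subseteq> (fboundaries 1 (top_of_set (star_conf k r L)) :: (_, 'f::field) fchain set)"
proof -
  let ?S = "star_conf k r L"
  let ?d = "\<lambda>x y. \<Sum>i=1..k. edge_length L i * \<bar>x i - y i\<bar>"
  let ?n = "\<lambda>x. \<Sum>i=1..k. x i :: real"
  \<comment> \<open>The end of the deformation. When \<open>r \<le> L\<close>, the sign of
    \<open>fst p 1 - snd p 1\<close> decides, even if one of the points lies off the edge of length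
    \<open>L\<close>. In the last case the coordinate sum \<open>?n\<close> is the parameter of a
    point, so division by it yields the leaf of its edge.\<close>
  define f where "f = (\<lambda>p :: (nat \<Rightarrow> real) \<times> (nat \<Rightarrow> real).
    if r \<le> L \<and> snd p 1 < fst p 1 then (star_point 1 1, star_point 1 0)
    else if r \<le> L \<and> fst p 1 < snd p 1 then (star_point 1 0, star_point 1 1)
    else (\<lambda>i. fst p i / ?n (fst p), \<lambda>i. snd p i / ?n (snd p)))"
  have E: "0 \<le> edge_length L i" for i using L by (simp add: edge_length_def)
  \<comment> \<open>Two points on one edge are no farther apart than its length. As
    \<open>r > 1\<close>, only the first edge is long enough.\<close>
  have same_edge: "r \<le> L \<and> x 1 \<noteq> y 1"
    if xy: "(x, y) \<in> ?S" and z: "\<And>j. j \<noteq> i \<Longrightarrow> x j = 0 \<and> y j = 0" for x y i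
  proof -
    have g: "x \<in> star_graph k" "y \<in> star_graph k" and d: "r \<le> ?d x y"
      using xy L by (auto simp: star_conf_iff)
    have "?d x y = (\<Sum>j=1..k. if j = i then edge_length L i * \<bar>x i - y i\<bar> else 0)"
      by (rule sum.cong) (use z in auto)
    also have "\<dots> \<le> edge_length L i * \<bar>x i - y i\<bar>" using E by simp
    finally have d': "r \<le> edge_length L i * \<bar>x i - y i\<bar>" using d by linarith
    have "\<bar>x i - y i\<bar> \<le> 1"
      using star_graph_bounds[OF g(1), of i] star_graph_bounds[OF g(2), of i] by auto
    then have "edge_length L i * \<bar>x i - y i\<bar> \<le> edge_length L i"
      using mult_left_mono[OF _ E] by fastforce
    then have "r \<le> edge_length L i" using d' by linarith
    then have "i = 1" "r \<le> L" using r by (auto simp: edge_length_def split: if_splits)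
    moreover have "x i \<noteq> y i" using d' r by auto
    ultimately show ?thesis by simp
  qed
  \<comment> \<open>By \<open>same_edge\<close> the points are then off the centre and on different
    edges, so their distance only grows when both move outwards.\<close>
  have apart: "(\<forall>i. x i = 0 \<or> y i = 0) \<and> 0 < ?n x \<and> 0 < ?n y"
    if xy: "(x, y) \<in> ?S" and n: "\<not> (r \<le> L \<and> x 1 \<noteq> y 1)" for x y
  proof -
    have g: "x \<in> star_graph k" "y \<in> star_graph k" using xy L by (auto simp: star_conf_iff)
    have pos: "0 < ?n x" if "x \<in> star_graph k" "x i \<noteq> 0" for x i
      using star_graph_support(1)[OF that] star_graph_bounds[OF that(1)] that(2)
      by (intro sum_pos2[of _ i]) (auto simp: less_le)
    have ne: "\<exists>j. j \<noteq> i \<and> (x j \<noteq> 0 \<or> y j \<noteq> 0)" for i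
      using same_edge[OF xy, of i] n by blast
    have "x i = 0 \<or> y i = 0" for i
      using ne[of i] star_graph_support(2)[OF g(1), of i] star_graph_support(2)[OF g(2), of i] by metis
    moreover obtain i where "x i \<noteq> 0"
      using ne star_graph_support(2)[OF g(2)] by metis
    moreover obtain i where "y i \<noteq> 0"
      using ne star_graph_support(2)[OF g(1)] by metis
    ultimately show ?thesis using pos g by blast
  qed
  have cv: "(1 - u) * s + u * t \<le> 1" if "s \<le> 1" "t \<le> 1" "0 \<le> u" "u \<le> 1" for s t u :: real
    using convex_bound_le[OF that(1,2), of "1 - u" u] that by simp
  \<comment> \<open>The coordinate sum is at most 1, so dividing by it never decreases a
    coordinate.\<close>
  have scale: "(\<lambda>i. (1 - u) * x i + u * (x i / ?n x)) \<in> star_graph k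
      \<and> (\<forall>i. x i \<le> (1 - u) * x i + u * (x i / ?n x))"
    if x: "x \<in> star_graph k" and n: "0 < ?n x" and u: "0 \<le> u" "u \<le> 1" for x u
  proof -
    note b = star_graph_bounds[OF x]
    have le: "x i / ?n x \<le> 1" for i
    proof (cases "x i = 0")
      case False
      then have "x i \<le> ?n x"
        using star_graph_support(1)[OF x] b by (intro member_le_sum) auto
      then show ?thesis using n by simp
    qed simp
    have ge: "x i \<le> x i / ?n x" for i
      using n sum_star_graph_le_1[OF x, of "{1..k}"] b[of i]
      by (simp add: le_divide_eq mult_left_le)
    have "(1 - u) * x i + u * x i \<le> (1 - u) * x i + u * (x i / ?n x)" for i
      using mult_left_mono[OF ge, of u] u by simp
    then have "\<forall>i. x i \<le> (1 - u) * x i + u * (x i / ?n x)" by (simp add: left_diff_distrib)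
    moreover have "(\<lambda>i. (1 - u) * x i + u * (x i / ?n x)) \<in> star_graph k"
    proof (rule star_graph_shrink[OF x])
      show "0 \<le> (1 - u) * x i + u * (x i / ?n x) \<and> (1 - u) * x i + u * (x i / ?n x) \<le> 1" for i
        using cv[OF b(2) le u, of i i] b(1)[of i] n u by simp
    qed simp
    ultimately show ?thesis by blast
  qed
  have push: "(\<lambda>i. (1 - u) * x i + u * star_point 1 1 i) \<in> star_graph k
      \<and> (\<lambda>i. (1 - u) * y i + u * star_point 1 0 i) \<in> star_graph k
      \<and> r \<le> ?d (\<lambda>i. (1 - u) * x i + u * star_point 1 1 i) (\<lambda>i. (1 - u) * y i + u * star_point 1 0 i)"
    if g: "x \<in> star_graph k" "y \<in> star_graph k" and d: "r \<le> ?d x y" and rL: "r \<le> L"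
      and less: "y 1 < x 1" and u: "0 \<le> u" "u \<le> 1" for x y u
  proof (intro conjI)
    have x1: "x 1 \<noteq> 0" using less star_graph_bounds[OF g(2), of 1] by auto
    have sp: "0 \<le> star_point 1 t i" "star_point 1 t i \<le> 1" if "0 \<le> t" "t \<le> 1" for t i
      using that by (auto simp: star_point_def)
    have bounds: "0 \<le> (1 - u) * z i + u * star_point 1 t i \<and> (1 - u) * z i + u * star_point 1 t i \<le> 1"
      if "z \<in> star_graph k" "0 \<le> t" "t \<le> 1" for z t i
      using cv[OF star_graph_bounds(2)[OF that(1), of i] sp(2)[OF that(2,3), of i] u]
        star_graph_bounds(1)[OF that(1), of i] sp(1)[OF that(2,3), of i] u by simp
    show "(\<lambda>i. (1 - u) * x i + u * star_point 1 1 i) \<in> star_graph k"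
      by (rule star_graph_shrink[OF g(1)], rule bounds[OF g(1)]) (use x1 in \<open>auto simp: star_point_def\<close>)
    show "(\<lambda>i. (1 - u) * y i + u * star_point 1 0 i) \<in> star_graph k"
      by (rule star_graph_shrink[OF g(2)], rule bounds[OF g(2)]) (auto simp: star_point_def)
    \<comment> \<open>The first coordinate of the difference keeps its sign and the others shrink by
      the factor \<open>1 - u\<close>. The distance thus interpolates affinely between its initial
      value and \<open>L\<close>, both at least \<open>r\<close>.\<close>
    have t: "edge_length L i * \<bar>((1 - u) * x i + u * star_point 1 1 i) - ((1 - u) * y i + u * star_point 1 0 i)\<bar>
        = (1 - u) * (edge_length L i * \<bar>x i - y i\<bar>) + (if i = 1 then u * L else 0)" for i
    proof (cases "i = 1")
      case True
      have eq: "((1 - u) * x 1 + u) - (1 - u) * y 1 = (1 - u) * \<bar>x 1 - y 1\<bar> + u"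
        using less by (simp add: algebra_simps)
      have "0 \<le> (1 - u) * \<bar>x 1 - y 1\<bar> + u" using u by simp
      then have "\<bar>((1 - u) * x 1 + u) - (1 - u) * y 1\<bar> = (1 - u) * \<bar>x 1 - y 1\<bar> + u"
        by (simp only: eq abs_of_nonneg)
      then show ?thesis by (simp add: True star_point_def edge_length_def distrib_left mult.left_commute mult.commute[of u L])
    next
      case False
      have "\<bar>(1 - u) * x i - (1 - u) * y i\<bar> = (1 - u) * \<bar>x i - y i\<bar>"
        using u by (simp add: abs_mult flip: right_diff_distrib)
      then show ?thesis using False by (simp add: star_point_def)
    qed
    have "?d (\<lambda>i. (1 - u) * x i + u * star_point 1 1 i) (\<lambda>i. (1 - u) * y i + u * star_point 1 0 i)
        = (1 - u) * ?d x y + u * L"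
      unfolding t sum.distrib sum_distrib_left[symmetric] using k by simp
    moreover have "(1 - u) * r + u * r \<le> (1 - u) * ?d x y + u * L"
      using u by (intro add_mono mult_left_mono d rL) auto
    ultimately show "r \<le> ?d (\<lambda>i. (1 - u) * x i + u * star_point 1 1 i) (\<lambda>i. (1 - u) * y i + u * star_point 1 0 i)"
      by (simp add: left_diff_distrib)
  qed
  have inside: "straight id f (u, (x, y)) \<in> ?S"
    if xy: "(x, y) \<in> ?S" and u: "0 \<le> u" "u \<le> 1" for x y u
  proof -
    have g: "x \<in> star_graph k" "y \<in> star_graph k" and d: "r \<le> ?d x y"
      using xy L by (auto simp: star_conf_iff)
    consider (1) "r \<le> L" "y 1 < x 1" | (2) "r \<le> L" "x 1 < y 1" | (3) "\<not> (r \<le> L \<and> x 1 \<noteq> y 1)"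
      by linarith
    then show ?thesis
    proof cases
      case 1
      then show ?thesis using push[OF g d 1 u] L
        by (simp add: straight_def f_def star_conf_iff)
    next
      case 2
      then show ?thesis using push[OF g(2,1) _ 2 u] d L
        by (simp add: straight_def f_def star_conf_iff abs_minus_commute)
    next
      case 3
      note a = apart[OF xy 3]
      define x' y' where "x' = (\<lambda>i. (1 - u) * x i + u * (x i / ?n x))"
        and "y' = (\<lambda>i. (1 - u) * y i + u * (y i / ?n y))"
      have x': "x' \<in> star_graph k" "\<And>i. x i \<le> x' i" and y': "y' \<in> star_graph k" "\<And>i. y i \<le> y' i"
        using scale[OF g(1) _ u] scale[OF g(2) _ u] a by (auto simp: x'_def y'_def)
      have "\<bar>x i - y i\<bar> \<le> \<bar>x' i - y' i\<bar>" for i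
        using a[THEN conjunct1, THEN spec, of i] x'(2)[of i] y'(2)[of i]
          star_graph_bounds(1)[OF g(1), of i] star_graph_bounds(1)[OF g(2), of i]
        by (auto simp: x'_def y'_def)
      then have "?d x y \<le> ?d x' y'" by (intro sum_mono mult_left_mono E)
      moreover have "straight id f (u, (x, y)) = (x', y')"
        using 3 by (auto simp: straight_def f_def x'_def y'_def)
      ultimately show ?thesis using x' y' d L by (simp add: star_conf_iff)
    qed
  qed
  \<comment> \<open>The cases of \<open>f\<close> are given by strict inequalities; this uniform gap
    turns them into closed conditions, which makes \<open>f\<close> continuous. Since
    \<open>x 1 \<noteq> 0\<close>, the point \<open>x\<close> lies on the first edge, so the other
    coordinates contribute at most 1 to the distance and the first one must supply
    \<open>r - 1\<close>.\<close>
  have gap: "(r - 1) / L \<le> x 1 - y 1"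
    if g: "x \<in> star_graph k" "y \<in> star_graph k" and d: "r \<le> ?d x y" and less: "y 1 < x 1" for x y
  proof -
    have x1: "x 1 \<noteq> 0" using less star_graph_bounds[OF g(2), of 1] by auto
    have "?d x y = L * (x 1 - y 1) + (\<Sum>i=Suc 1..k. edge_length L i * \<bar>x i - y i\<bar>)"
      using k less by (simp add: sum.atLeast_Suc_atMost edge_length_def)
    also have "(\<Sum>i=Suc 1..k. edge_length L i * \<bar>x i - y i\<bar>) = (\<Sum>i=Suc 1..k. y i)"
    proof (rule sum.cong[OF HOL.refl])
      fix i assume i: "i \<in> {Suc 1..k}"
      then have "x i = 0" using star_graph_support(2)[OF g(1) x1, of i] by auto
      then show "edge_length L i * \<bar>x i - y i\<bar> = y i"
        using i star_graph_bounds[OF g(2), of i] by (simp add: edge_length_def)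
    qed
    also have "\<dots> \<le> 1" by (rule sum_star_graph_le_1[OF g(2)]) simp
    finally have "r - 1 \<le> L * (x 1 - y 1)" using d by simp
    then show ?thesis using L by (simp add: field_simps)
  qed
  have cont_apart: "continuous_on A f"
    if A: "A \<subseteq> ?S" "\<And>x y. (x, y) \<in> A \<Longrightarrow> \<not> (r \<le> L \<and> x 1 \<noteq> y 1)" for A
  proof -
    have n: "?n (fst p) \<noteq> 0" "?n (snd p) \<noteq> 0" if "p \<in> A" for p
      using apart[of "fst p" "snd p"] A that by (force simp del: sum_eq_0_iff)+
    have "continuous_on A (\<lambda>p. (\<lambda>i. fst p i / ?n (fst p), \<lambda>i. snd p i / ?n (snd p)))"
      by (intro continuous_on_Pair continuous_on_coordinatewise_then_product continuous_intros ballI n)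
    then show ?thesis
      by (rule continuous_on_eq) (use A(2) in \<open>force simp: f_def\<close>)
  qed
  have cont: "continuous_on ?S f"
  proof (cases "r \<le> L")
    case True
    let ?c = "(r - 1) / L"
    have c: "0 < ?c" using r L by simp
    define T :: "nat \<Rightarrow> ((nat \<Rightarrow> real) \<times> (nat \<Rightarrow> real)) set" where
      "T j = (if j = 0 then {p. ?c \<le> fst p 1 - snd p 1} else if j = 1 then {p. ?c \<le> snd p 1 - fst p 1}
        else {p. fst p 1 = snd p 1})" for j
    show ?thesis
    proof (rule continuous_on_finite_closed_cover[of "{0,1,2}" T])
      have cl: "closed {p :: (nat \<Rightarrow> real) \<times> (nat \<Rightarrow> real). ?c \<le> fst p 1 - snd p 1}"
        "closed {p :: (nat \<Rightarrow> real) \<times> (nat \<Rightarrow> real). ?c \<le> snd p 1 - fst p 1}"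
        "closed {p :: (nat \<Rightarrow> real) \<times> (nat \<Rightarrow> real). fst p 1 = snd p 1}"
        by (intro closed_Collect_le closed_Collect_eq continuous_intros)+
      show "closed (T i)" if "i \<in> {0,1,2}" for i
        using that cl by (auto simp: T_def)
      show "?S \<subseteq> (\<Union>i\<in>{0,1,2}. T i)"
      proof clarify
        fix x y assume "(x, y) \<in> ?S"
        then have g: "x \<in> star_graph k" "y \<in> star_graph k" and d: "r \<le> ?d x y" "r \<le> ?d y x"
          using L by (auto simp: star_conf_iff abs_minus_commute)
        show "(x, y) \<in> (\<Union>i\<in>{0,1,2}. T i)"
          using gap[OF g d(1)] gap[OF g(2,1) d(2)]
          by (cases "x 1" "y 1" rule: linorder_cases) (auto simp: T_def)
      qed
      show "continuous_on (?S \<inter> T i) f" if i: "i \<in> {0,1,2}" for i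
      proof -
        consider "i = 0" | "i = 1" | "i = 2" using i by auto
        then show ?thesis
        proof cases
          case 1
          have "continuous_on (?S \<inter> T i) (\<lambda>p. (star_point 1 1, star_point 1 0))" by simp
          then show ?thesis
            by (rule continuous_on_eq) (use True c in \<open>auto simp: f_def T_def 1\<close>)
        next
          case 2
          have "continuous_on (?S \<inter> T i) (\<lambda>p. (star_point 1 0, star_point 1 1))" by simp
          then show ?thesis
            by (rule continuous_on_eq) (use True c in \<open>auto simp: f_def T_def 2\<close>)
        next
          case 3
          then show ?thesis by (intro cont_apart) (auto simp: T_def)
        qed
      qed
    qed simp
  next
    case False
    then show ?thesis by (intro cont_apart) auto
  qed
  \<comment> \<open>The centre and the leaves: \<open>f\<close> takes values in pairs of these, a
    finite set.\<close>
  let ?V = "(\<lambda>(i, t). star_point i t) ` ({1..k} \<times> {0, 1})"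
  have vertex: "(\<lambda>i. x i / ?n x) \<in> ?V" if x: "x \<in> star_graph k" and n: "0 < ?n x" for x
  proof -
    obtain i t where it: "x = star_point i t" "i \<in> {1..k}" using x by (auto simp: star_graph_def)
    have "?n x = t" using it by (simp add: star_point_def)
    then have "(\<lambda>i. x i / ?n x) = star_point i 1" using n it by (auto simp: star_point_def)
    then show ?thesis using it by (auto intro!: image_eqI[of _ _ "(i, 1)"])
  qed
  have "f p \<in> ?V \<times> ?V" if "p \<in> ?S" for p
  proof -
    obtain x y where p: "p = (x, y)" by (cases p)
    have g: "x \<in> star_graph k" "y \<in> star_graph k" using that L by (auto simp: p star_conf_iff)
    have s: "star_point 1 1 \<in> ?V" "star_point 1 0 \<in> ?V"
      by (rule image_eqI[of _ _ "(1, 1)"] image_eqI[of _ _ "(1, 0)"]; use k in simp)+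
    show ?thesis
    proof (cases "r \<le> L \<and> x 1 \<noteq> y 1")
      case True
      then show ?thesis using s by (auto simp: f_def p)
    next
      case False
      then show ?thesis
        using apart[OF that[unfolded p] False] vertex[OF g(1)] vertex[OF g(2)] by (auto simp: f_def p)
    qed
  qed
  then have "f ` ?S \<subseteq> ?V \<times> ?V" by (rule image_subsetI)
  moreover have "finite (?V \<times> ?V)"
    by (intro finite_cartesian_product finite_imageI finite_atLeastAtMost finite.intros)
  ultimately have "finite (f ` ?S)" by (rule finite_subset)
  moreover have "continuous_map (prod_topology (top_of_set {0..1}) (top_of_set ?S)) (top_of_set ?S)
      (straight id f)"
    using continuous_on_straight[OF continuous_on_id' cont] inside by auto
  ultimately show ?thesis
    by (intro fcycles_1_subset_fboundaries[of ?S "straight id f"]) simp_all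
qed

section \<open>Retracting the skeleton\<close>

lemma sum_star_point:
  "finite T \<Longrightarrow> (\<Sum>j\<in>T. star_point i t j) = (if i \<in> T then t else 0)"
  by (simp add: star_point_def)

lemma star_point_pair_in_skeleton:
  assumes "T \<subseteq> {1..k}" "i \<in> T" "j \<in> T" "i \<noteq> j" "s \<in> {0..1}" "t \<in> {0..1}" "max s t = 1"
  shows "(star_point i s, star_point j t) \<in> star_skeleton k T"
proof -
  have "finite T" using assms(1) by (rule finite_subset) simp
  moreover have "star_point i s \<in> star_graph k" "star_point j t \<in> star_graph k"
    using assms by (auto intro!: star_point_in)
  ultimately show ?thesis
    using assms by (auto simp: star_skeleton_def sum_star_point) (auto simp: star_point_def)
qed

lemma star_point_0: "star_point i 0 = star_point j 0"
  by (auto simp: star_point_def)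

lemma continuous_on_star_point:
  assumes "continuous_on S f"
  shows "continuous_on S (\<lambda>u. star_point i (f u))"
proof (rule continuous_on_coordinatewise_then_product)
  fix j
  show "continuous_on S (\<lambda>u. star_point i (f u) j)"
    using assms by (cases "j = i") (simp_all add: star_point_def)
qed

text \<open>This is one edge of the model graph: the first point walks out to its leaf while the
  second waits at its own, then the second walks in to the centre.\<close>

lemma path_component_arm:
  assumes "T \<subseteq> {1..k}" "i \<in> T" "j \<in> T" "i \<noteq> j"
  shows "path_component (star_skeleton k T) (star_point j 0, star_point j 1) (star_point i 1, star_point i 0)"
  unfolding path_component_def
proof (intro exI conjI)
  \<comment> \<open>Clipping at 1 keeps one of the two points at a leaf at all times: the second up
    to \<open>u = 1/2\<close>, the first from then on.\<close>
  let ?g = "\<lambda>u::real. (star_point i (min 1 (2 * u)), star_point j (min 1 (2 - 2 * u)))"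
  show "path ?g"
    unfolding path_def by (intro continuous_on_Pair continuous_on_star_point continuous_intros)
  show "path_image ?g \<subseteq> star_skeleton k T"
    unfolding path_image_def using assms
    by (auto intro!: star_point_pair_in_skeleton)
  show "pathstart ?g = (star_point j 0, star_point j 1)" "pathfinish ?g = (star_point i 1, star_point i 0)"
    by (auto simp: pathstart_def pathfinish_def star_point_0[of i j])
qed

text \<open>No edge of the model graph joins the two vertices belonging to the same element of
  \<open>T\<close>, so the paths go through a vertex of some further element \<open>l\<close>; three
  elements are enough for this.\<close>

lemma path_component_skeleton_vertices:
  assumes T: "T \<subseteq> {1..k}" "card T \<ge> 3" and ij: "i \<in> T" "j \<in> T"
  shows "path_component (star_skeleton k T) (star_point j 0, star_point j 1) (star_point i 0, star_point i 1)"
    and "path_component (star_skeleton k T) (star_point j 1, star_point j 0) (star_point i 0, star_point i 1)"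
proof -
  have fT: "finite T" using T(1) by (rule finite_subset) simp
  have third: "\<exists>l\<in>T. l \<noteq> a \<and> l \<noteq> b" for a b
  proof (rule ccontr)
    assume "\<not> ?thesis"
    then have "T \<subseteq> {a, b}" by blast
    then have "card T \<le> card {a, b}" by (rule card_mono[rotated]) simp
    also have "\<dots> \<le> 2" by (simp add: card_insert_if)
    finally show False using T(2) by simp
  qed
  note arm = path_component_arm[OF T(1)]
  have 1: "path_component (star_skeleton k T) (star_point j 0, star_point j 1) (star_point i 0, star_point i 1)"
    if "i \<in> T" "j \<in> T" for i j
  proof -
    obtain l where l: "l \<in> T" "l \<noteq> i" "l \<noteq> j" using third by blast
    show ?thesis
      using path_component_trans[OF arm[OF l(1) that(2) l(3)] path_component_sym[OF arm[OF l(1) that(1) l(2)]]] .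
  qed
  then show "path_component (star_skeleton k T) (star_point j 0, star_point j 1) (star_point i 0, star_point i 1)"
    using ij by blast
  obtain l where l: "l \<in> T" "l \<noteq> j" using third by blast
  show "path_component (star_skeleton k T) (star_point j 1, star_point j 0) (star_point i 0, star_point i 1)"
    using path_component_trans[OF path_component_sym[OF arm[OF ij(2) l(1)]] 1[OF ij(1) l(1)]] l(2) by simp
qed

text \<open>The part of the skeleton outside the retract consists of two cones, with apexes at the leaf of
  \<open>e\<^sub>1\<close> paired with the centre and vice versa, over finite subsets of the retract; since the retract is
  path connected, the identity extends over them.\<close>

lemma skeleton_retraction:
  assumes k: "k \<ge> 4"
  obtains \<rho> where "continuous_map (top_of_set (star_skeleton k {1..k})) (top_of_set (star_skeleton k {2..k})) \<rho>"
    "\<And>p. p \<in> star_skeleton k {2..k} \<Longrightarrow> \<rho> p = p"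
proof -
  let ?Z = "star_skeleton k {1..k}" and ?Z' = "star_skeleton k {2..k}"
  \<comment> \<open>An arbitrary base point of the smaller graph; both cone apexes are sent to
    it.\<close>
  define w where "w = (star_point 2 0, star_point 2 1)"
  have T: "{2..k} \<subseteq> {1..k}" "card {2..k} \<ge> 3" "2 \<in> {2..k}" using k by auto
  have "\<exists>g. path g \<and> path_image g \<subseteq> ?Z' \<and> pathstart g = (star_point j 0, star_point j 1) \<and> pathfinish g = w"
    if "j \<in> {2..k}" for j
    using path_component_skeleton_vertices(1)[OF T that] by (simp add: path_component_def w_def)
  then obtain \<gamma> where \<gamma>: "\<And>j. j \<in> {2..k} \<Longrightarrow> path (\<gamma> j) \<and> path_image (\<gamma> j) \<subseteq> ?Z' \<and>
      pathstart (\<gamma> j) = (star_point j 0, star_point j 1) \<and> pathfinish (\<gamma> j) = w"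
    by metis
  have "\<exists>g. path g \<and> path_image g \<subseteq> ?Z' \<and> pathstart g = (star_point j 1, star_point j 0) \<and> pathfinish g = w"
    if "j \<in> {2..k}" for j
    using path_component_skeleton_vertices(2)[OF T that] by (simp add: path_component_def w_def)
  then obtain \<gamma>' where \<gamma>': "\<And>j. j \<in> {2..k} \<Longrightarrow> path (\<gamma>' j) \<and> path_image (\<gamma>' j) \<subseteq> ?Z' \<and>
      pathstart (\<gamma>' j) = (star_point j 1, star_point j 0) \<and> pathfinish (\<gamma>' j) = w"
    by metis
  \<comment> \<open>Index (0,0) stands for the smaller graph, (1,j) for the arm with the first point
    on edge 1 and the second on edge j, and (2,j) for the same with the points exchanged.\<close>
  define I :: "(nat \<times> nat) set" where "I = insert (0, 0) ({1, 2} \<times> {2..k})"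
  define T :: "nat \<times> nat \<Rightarrow> ((nat \<Rightarrow> real) \<times> (nat \<Rightarrow> real)) set" where
    "T = (\<lambda>(c, j). if c = 0 then {p. fst p 1 = 0 \<and> snd p 1 = 0}
       else if c = 1 then {p. (\<forall>i. i \<noteq> 1 \<longrightarrow> fst p i = 0) \<and> (\<forall>i. i \<noteq> j \<longrightarrow> snd p i = 0)}
       else {p. (\<forall>i. i \<noteq> j \<longrightarrow> fst p i = 0) \<and> (\<forall>i. i \<noteq> 1 \<longrightarrow> snd p i = 0)})"
  \<comment> \<open>On an arm the larger of the two parameters is 1, so this expression runs from 0
    at the base, where the point on edge 1 is at the centre, to 1 at the apex, where the other point
    is. The arm is thus laid along the chosen path from its base point to \<open>w\<close>.\<close>
  define f where "f = (\<lambda>(c, j) p. if c = (0::nat) then p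
       else if c = 1 then \<gamma> j ((1 + fst p 1 - snd p j) / 2)
       else \<gamma>' j ((1 + snd p 1 - fst p j) / 2))"
  have Zd: "x \<in> star_graph k" "y \<in> star_graph k" "\<And>i. x i = 0 \<or> y i = 0"
    "max (\<Sum>i=1..k. x i) (\<Sum>i=1..k. y i) = 1" if "(x, y) \<in> ?Z" for x y
    using that by (auto simp: star_skeleton_def)
  have single: "(\<Sum>i=1..k. x i) = x j" "x = star_point j (x j)"
    if "\<And>i. i \<noteq> j \<Longrightarrow> x i = 0" "x \<in> star_graph k" for x j
  proof -
    show e: "x = star_point j (x j)" using that(1) by (auto simp: star_point_def)
    have "(\<Sum>i=1..k. star_point j (x j) i) = (if j \<in> {1..k} then x j else 0)"
      by (simp add: sum_star_point)
    then show "(\<Sum>i=1..k. x i) = x j"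
      using star_graph_support(1)[OF that(2), of j] e by (metis (no_types, lifting) sum.cong)
  qed
  \<comment> \<open>Different arms of one cone meet only in the apex, where all the maps take the
    value \<open>w\<close>. The facts \<open>f01\<close> and \<open>f02\<close> treat the bases,
    where an arm meets the smaller graph.\<close>
  have f1: "f (1, j) (x, y) = w" if "(x, y) \<in> ?Z" "(x, y) \<in> T (1, j)" "j \<in> {2..k}" "y j = 0" for x y j
  proof -
    note z = Zd[OF that(1)]
    have "\<And>i. i \<noteq> 1 \<Longrightarrow> x i = 0" "\<And>i. y i = 0" using that by (auto simp: T_def)
    then have "x 1 = 1" using z(4) single(1)[of 1 x, OF _ z(1)] by (simp add: max_def split: if_splits)
    then show ?thesis using \<gamma>[OF that(3)] that(4) by (simp add: f_def pathfinish_def)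
  qed
  have f2: "f (2, j) (x, y) = w" if "(x, y) \<in> ?Z" "(x, y) \<in> T (2, j)" "j \<in> {2..k}" "x j = 0" for x y j
  proof -
    note z = Zd[OF that(1)]
    have "\<And>i. i \<noteq> 1 \<Longrightarrow> y i = 0" "\<And>i. x i = 0" using that by (auto simp: T_def)
    then have "y 1 = 1" using z(4) single(1)[of 1 y, OF _ z(2)] by (simp add: max_def split: if_splits)
    then show ?thesis using \<gamma>'[OF that(3)] that(4) by (simp add: f_def pathfinish_def)
  qed
  have f01: "f (1, j) (x, y) = (x, y)"
    if "(x, y) \<in> ?Z" "(x, y) \<in> T (1, j)" "j \<in> {2..k}" "(x, y) \<in> T (0, 0)" for x y j
  proof -
    note z = Zd[OF that(1)]
    have x0: "x i = 0" for i using that by (cases "i = 1") (auto simp: T_def)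
    have yj: "\<And>i. i \<noteq> j \<Longrightarrow> y i = 0" using that by (auto simp: T_def)
    have "y j = 1" using z(4) single(1)[of j y, OF yj z(2)] x0 by (simp add: max_def split: if_splits)
    moreover have "x = star_point j 0" using x0 by (auto simp: star_point_def)
    moreover have "y = star_point j (y j)" by (rule single(2)[OF yj z(2)])
    ultimately show ?thesis using \<gamma>[OF that(3)] x0 by (simp add: f_def pathstart_def)
  qed
  have f02: "f (2, j) (x, y) = (x, y)"
    if "(x, y) \<in> ?Z" "(x, y) \<in> T (2, j)" "j \<in> {2..k}" "(x, y) \<in> T (0, 0)" for x y j
  proof -
    note z = Zd[OF that(1)]
    have y0: "y i = 0" for i using that by (cases "i = 1") (auto simp: T_def)
    have xj: "\<And>i. i \<noteq> j \<Longrightarrow> x i = 0" using that by (auto simp: T_def)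
    have "x j = 1" using z(4) single(1)[of j x, OF xj z(1)] y0 by (simp add: max_def split: if_splits)
    moreover have "y = star_point j 0" using y0 by (auto simp: star_point_def)
    moreover have "x = star_point j (x j)" by (rule single(2)[OF xj z(1)])
    ultimately show ?thesis using \<gamma>'[OF that(3)] y0 by (simp add: f_def pathstart_def)
  qed
  \<comment> \<open>The two cones are disjoint: as \<open>l\<close> and \<open>j\<close> differ from
    1, a common point would have both components at the centre.\<close>
  have no12: False if "(x, y) \<in> ?Z" "(x, y) \<in> T (1, j)" "(x, y) \<in> T (2, l)" "j \<in> {2..k}" "l \<in> {2..k}" for x y j l
  proof -
    have "x i = 0" "y i = 0" for i
      using that(2-5) by (cases "i = 1"; auto simp: T_def)+
    then show False using Zd(4)[OF that(1)] by simp
  qed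
  obtain \<rho> where \<rho>: "continuous_map (top_of_set ?Z) (top_of_set ?Z') \<rho>"
    "\<And>p i. \<lbrakk>i \<in> I; p \<in> topspace (top_of_set ?Z) \<inter> (?Z \<inter> T i)\<rbrakk> \<Longrightarrow> \<rho> p = f i p"
  proof (rule pasting_lemma_exists_closed[of I "top_of_set ?Z" "\<lambda>i. ?Z \<inter> T i" "top_of_set ?Z'" f])
    show "finite I" by (simp add: I_def)
    show "topspace (top_of_set ?Z) \<subseteq> (\<Union>i\<in>I. ?Z \<inter> T i)"
    proof
      fix p assume "p \<in> topspace (top_of_set ?Z)"
      then obtain x y where p: "p = (x, y)" and xy: "(x, y) \<in> ?Z" by (cases p) auto
      note z = Zd[OF xy]
      \<comment> \<open>If \<open>v\<close> is the centre, that is at an apex, any edge will do, and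
        2 is taken.\<close>
      have other: "\<exists>j\<in>{2..k}. \<forall>i. i \<noteq> j \<longrightarrow> v i = 0" if "v \<in> star_graph k" "v 1 = 0" for v
      proof (cases "\<exists>j. v j \<noteq> 0")
        case True
        then obtain j where j: "v j \<noteq> 0" by blast
        then have "j \<in> {1..k}" "j \<noteq> 1" using star_graph_support(1)[OF that(1)] that(2) by auto
        then show ?thesis using star_graph_support(2)[OF that(1) j] by (intro bexI[of _ j]) auto
      next
        case False
        then show ?thesis using k by (intro bexI[of _ 2]) auto
      qed
      consider "x 1 = 0" "y 1 = 0" | "x 1 \<noteq> 0" "y 1 = 0" | "x 1 = 0" "y 1 \<noteq> 0" using z(3)[of 1] by blast
      then show "p \<in> (\<Union>i\<in>I. ?Z \<inter> T i)"
      proof cases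
        case 1
        then show ?thesis using xy by (auto simp: p I_def T_def)
      next
        case 2
        obtain j where j: "j \<in> {2..k}" "\<forall>i. i \<noteq> j \<longrightarrow> y i = 0" using other[OF z(2) 2(2)] by blast
        have "(x, y) \<in> T (1, j)" using j star_graph_support(2)[OF z(1) 2(1)] by (auto simp: T_def)
        then show ?thesis using xy j(1) by (auto simp: p I_def)
      next
        case 3
        obtain j where j: "j \<in> {2..k}" "\<forall>i. i \<noteq> j \<longrightarrow> x i = 0" using other[OF z(1) 3(1)] by blast
        have "(x, y) \<in> T (2, j)" using j star_graph_support(2)[OF z(2) 3(2)] by (auto simp: T_def)
        then show ?thesis using xy j(1) by (auto simp: p I_def)
      qed
    qed
    show "closedin (top_of_set ?Z) (?Z \<inter> T i)" if "i \<in> I" for i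
    proof (rule closedin_closed_Int)
      have c: "closed {p :: (nat \<Rightarrow> real) \<times> (nat \<Rightarrow> real). fst p a = 0}"
        "closed {p :: (nat \<Rightarrow> real) \<times> (nat \<Rightarrow> real). snd p a = 0}" for a
        by (intro closed_Collect_eq continuous_intros)+
      have c': "closed {p :: (nat \<Rightarrow> real) \<times> (nat \<Rightarrow> real). \<forall>i. i \<noteq> a \<longrightarrow> fst p i = 0}"
        "closed {p :: (nat \<Rightarrow> real) \<times> (nat \<Rightarrow> real). \<forall>i. i \<noteq> a \<longrightarrow> snd p i = 0}" for a
        by (intro closed_Collect_all closed_Collect_imp c open_Collect_const)+
      show "closed (T i)"
        unfolding T_def case_prod_beta by (auto intro!: closed_Collect_conj c c')
    qed
    show "f i p = f j p" if "i \<in> I" "j \<in> I"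
      "p \<in> topspace (top_of_set ?Z) \<inter> (?Z \<inter> T i) \<inter> (?Z \<inter> T j)" for i j p
    proof -
      obtain x y where p: "p = (x, y)" by (cases p)
      have xy: "(x, y) \<in> ?Z" "(x, y) \<in> T i" "(x, y) \<in> T j" using that(3) by (auto simp: p)
      have f0: "f (0, 0) q = q" for q by (simp add: f_def)
      have y0: "y a = 0" if "(x, y) \<in> T (1, a)" "(x, y) \<in> T (1, b)" "a \<noteq> b" for a b
        using that by (auto simp: T_def)
      have x0: "x a = 0" if "(x, y) \<in> T (2, a)" "(x, y) \<in> T (2, b)" "a \<noteq> b" for a b
        using that by (auto simp: T_def)
      have 11: "f (1, a) (x, y) = f (1, b) (x, y)"
        if "(x, y) \<in> T (1, a)" "(x, y) \<in> T (1, b)" "a \<in> {2..k}" "b \<in> {2..k}" for a b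
        using f1[OF xy(1) that(1,3)] f1[OF xy(1) that(2,4)] y0[OF that(1,2)] y0[OF that(2,1)] by metis
      have 22: "f (2, a) (x, y) = f (2, b) (x, y)"
        if "(x, y) \<in> T (2, a)" "(x, y) \<in> T (2, b)" "a \<in> {2..k}" "b \<in> {2..k}" for a b
        using f2[OF xy(1) that(1,3)] f2[OF xy(1) that(2,4)] x0[OF that(1,2)] x0[OF that(2,1)] by metis
      have I: "i = (0, 0) \<or> (\<exists>a\<in>{2..k}. i = (1, a)) \<or> (\<exists>a\<in>{2..k}. i = (2, a))" if "i \<in> I" for i
        using that by (auto simp: I_def)
      show ?thesis
        unfolding p
        using I[OF that(1)] I[OF that(2)] xy f0 f01 f02 11 22 no12[OF xy(1)] by (elim disjE bexE) metis+
    qed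
    have arm: "continuous_map (top_of_set (?Z \<inter> A)) (top_of_set ?Z') (\<lambda>p. g (t p))"
      if "path g" "path_image g \<subseteq> ?Z'" "continuous_on (?Z \<inter> A) t" "t \<in> ?Z \<inter> A \<rightarrow> {0..1}" for A g t
    proof -
      have "continuous_on (?Z \<inter> A) (\<lambda>p. g (t p))"
        by (rule continuous_on_compose2[OF that(1)[unfolded path_def] that(3)]) (use that(4) in blast)
      moreover have "g (t p) \<in> ?Z'" if "p \<in> ?Z \<inter> A" for p
        using that \<open>t \<in> ?Z \<inter> A \<rightarrow> {0..1}\<close> \<open>path_image g \<subseteq> ?Z'\<close> unfolding path_image_def by blast
      ultimately show ?thesis by (simp add: Pi_iff)
    qed
    have range: "0 \<le> (1 + x a - y b) / 2" "(1 + x a - y b) / 2 \<le> 1" "0 \<le> (1 + y a - x b) / 2"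
      "(1 + y a - x b) / 2 \<le> 1" if "(x, y) \<in> ?Z" for x y a b
      using star_graph_bounds[OF Zd(1)[OF that], of a] star_graph_bounds[OF Zd(2)[OF that], of a]
        star_graph_bounds[OF Zd(1)[OF that], of b] star_graph_bounds[OF Zd(2)[OF that], of b]
      by simp_all
    show "continuous_map (subtopology (top_of_set ?Z) (?Z \<inter> T i)) (top_of_set ?Z') (f i)" if i: "i \<in> I" for i
    proof -
      consider "i = (0, 0)" | j where "i = (1, j)" "j \<in> {2..k}" | j where "i = (2, j)" "j \<in> {2..k}"
        using i unfolding I_def by blast
      then have "continuous_map (top_of_set (?Z \<inter> T i)) (top_of_set ?Z') (f i)"
      proof cases
        case 1
        have "x \<in> star_graph k \<Longrightarrow> x 1 = 0 \<Longrightarrow> (\<Sum>i=1..k. x i) = (\<Sum>i=2..k. x i)" for x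
          using k by (simp add: sum.atLeast_Suc_atMost numeral_2_eq_2)
        moreover have "i \<in> {1..k}" if "i \<noteq> 0" "i \<le> k" for i using that by auto
        ultimately have "?Z \<inter> T (0, 0) \<subseteq> ?Z'"
          by (auto simp: star_skeleton_def T_def)
             (metis One_nat_def Suc_leI Suc_1 le_antisym not_less_eq_eq)+
        then show ?thesis unfolding 1 by (auto simp: f_def continuous_on_id)
      next
        case (2 j)
        have "continuous_map (top_of_set (?Z \<inter> T i)) (top_of_set ?Z') (\<lambda>p. \<gamma> j ((1 + fst p 1 - snd p j) / 2))"
          by (rule arm) (use \<gamma>[OF 2(2)] range in \<open>auto intro!: continuous_intros\<close>)
        then show ?thesis by (simp add: 2(1) f_def)
      next
        case (3 j)
        have "continuous_map (top_of_set (?Z \<inter> T i)) (top_of_set ?Z') (\<lambda>p. \<gamma>' j ((1 + snd p 1 - fst p j) / 2))"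
          by (rule arm) (use \<gamma>'[OF 3(2)] range in \<open>auto intro!: continuous_intros\<close>)
        then show ?thesis by (simp add: 3(1) f_def)
      qed
      then show ?thesis by (simp add: subtopology_subtopology Int_absorb1)
    qed
    fix g assume "continuous_map (top_of_set ?Z) (top_of_set ?Z') g"
      "\<And>p i. \<lbrakk>i \<in> I; p \<in> topspace (top_of_set ?Z) \<inter> (?Z \<inter> T i)\<rbrakk> \<Longrightarrow> g p = f i p"
    then show thesis by (rule that)
  qed
  show thesis
  proof (rule that[OF \<rho>(1)])
    fix p assume p: "p \<in> ?Z'"
    have "(\<Sum>i=1..k. x i) = (\<Sum>i=2..k. x i)" if "x 1 = 0" for x :: "nat \<Rightarrow> real"
      using k that by (simp add: sum.atLeast_Suc_atMost numeral_2_eq_2)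
    then have "p \<in> ?Z" "p \<in> T (0, 0)"
      using p by (auto simp: star_skeleton_def T_def)
    then show "\<rho> p = p" using \<rho>(2)[of "(0, 0)" p] by (simp add: I_def f_def)
  qed
qed

section \<open>The decomposition\<close>

text \<open>Two scales always have a common upper bound, with the smaller \<open>r\<close> and the
  larger \<open>L\<close>. It lies in an upward closed set containing them, so such a set is
  connected in two steps.\<close>

lemma poset_interval_scale:
  assumes "I \<subseteq> scale_poset" "I \<noteq> {}"
    and up: "\<And>p q. p \<in> I \<Longrightarrow> q \<in> scale_poset \<Longrightarrow> scale_le p q \<Longrightarrow> q \<in> I"
  shows "poset_interval scale_poset scale_le I"
  unfolding poset_interval_def poset_connected_def poset_convex_def
proof (intro conjI ballI impI assms(1,2))
  fix a b assume ab: "a \<in> I" "b \<in> I"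
  let ?R = "{(x, y). x \<in> I \<and> y \<in> I \<and> (scale_le x y \<or> scale_le y x)}"
  define c where "c = (min (fst a) (fst b), max (snd a) (snd b))"
  have P: "a \<in> scale_poset" "b \<in> scale_poset" using ab assms(1) by auto
  have le: "scale_le a c" "scale_le b c" by (auto simp: scale_le_def c_def case_prod_beta)
  have "c \<in> scale_poset" using P by (auto simp: scale_poset_def c_def)
  then have "c \<in> I" using up[OF ab(1) _ le(1)] by blast
  then have "(a, c) \<in> ?R" "(c, b) \<in> ?R" using ab le by auto
  then show "(a, b) \<in> ?R\<^sup>*" by (meson r_into_rtrancl rtrancl_trans)
next
  fix a c b
  assume "a \<in> I" "b \<in> scale_poset" "scale_le a b"
  then show "b \<in> I" by (rule up)
qed

lemma deformation_star_conf_all: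
  assumes "0 < r" "r \<le> 1" "r \<le> L"
  shows "deformation (star_conf k r L) (star_skeleton k {1..k}) (straight id (project {1..k}))"
proof (rule deformation_star_conf)
  show "\<exists>i\<in>{1..k}. x i \<noteq> y i" if "(x, y) \<in> star_conf k r L" for x y
  proof (rule ccontr)
    assume "\<not> ?thesis"
    then have "(\<Sum>i=1..k. edge_length L i * \<bar>x i - y i\<bar>) = 0" by simp
    then show False using that assms by (simp add: star_conf_iff)
  qed
qed (use assms in \<open>auto simp: edge_length_def\<close>)

text \<open>The first edge may be forgotten because it cannot separate the points by itself: if all
  other coordinates agree, the distance is at most \<open>L\<close>, which is below
  \<open>r\<close>.\<close>

lemma deformation_star_conf_short:
  assumes "0 < L" "L < r" "r \<le> 1" "k \<ge> 1"
  shows "deformation (star_conf k r L) (star_skeleton k {2..k}) (straight id (project {2..k}))"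
proof (rule deformation_star_conf)
  show "\<exists>i\<in>{2..k}. x i \<noteq> y i" if "(x, y) \<in> star_conf k r L" for x y
  proof (rule ccontr)
    assume "\<not> ?thesis"
    then have "(\<Sum>i=Suc 1..k. edge_length L i * \<bar>x i - y i\<bar>) = 0" by (auto intro!: sum.neutral)
    then have "(\<Sum>i=1..k. edge_length L i * \<bar>x i - y i\<bar>) = L * \<bar>x 1 - y 1\<bar>"
      using assms by (simp add: sum.atLeast_Suc_atMost edge_length_def)
    moreover have "x \<in> star_graph k" "y \<in> star_graph k"
      using that assms by (auto simp: star_conf_iff)
    then have "\<bar>x 1 - y 1\<bar> \<le> 1"
      using star_graph_bounds[of x k 1] star_graph_bounds[of y k 1] by (simp add: abs_le_iff)
    then have "L * \<bar>x 1 - y 1\<bar> \<le> L" using assms by (simp add: mult_left_le)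
    moreover have "r \<le> (\<Sum>i=1..k. edge_length L i * \<bar>x i - y i\<bar>)"
      using that assms by (simp add: star_conf_iff)
    ultimately show False using assms(2) by linarith
  qed
qed (use assms in \<open>auto simp: edge_length_def\<close>)

lemma star_PH_eq_filtration_PH:
  "star_PH k i = filtration_PH i (\<lambda>p. star_conf k (fst p) (snd p))"
  by (auto simp: star_PH_def filtration_PH_def fun_eq_iff)

theorem theorem1p4:
  fixes k :: nat
  assumes "k \<ge> 4"
  shows "interval_decomposable scale_poset scale_le
           (star_PH k 1 :: (real \<times> real, 'f::field, _) pmod)"
proof -
  let ?Z = "top_of_set (star_skeleton k {1..k})" and ?Z' = "top_of_set (star_skeleton k {2..k})"
  let ?S = "\<lambda>p. star_conf k (fst p) (snd p)"
  have sub: "star_skeleton k {2..k} \<subseteq> star_skeleton k {1..k}"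
  proof -
    have "(\<Sum>i=1..k. x i) = (\<Sum>i=2..k. x i)" if "x 1 = 0" for x :: "nat \<Rightarrow> real"
      using assms that by (simp add: sum.atLeast_Suc_atMost numeral_2_eq_2)
    then show ?thesis by (auto simp: star_skeleton_def)
  qed
  obtain \<rho> where \<rho>: "continuous_map ?Z ?Z' \<rho>" "\<And>p. p \<in> star_skeleton k {2..k} \<Longrightarrow> \<rho> p = p"
    using skeleton_retraction[OF assms] by blast
  \<comment> \<open>A cycle of the smaller graph that bounds in the larger already bounds in the
    smaller, by applying the retraction to the bounding chain.\<close>
  have reflect: "fcycles 1 ?Z' \<inter> fboundaries 1 ?Z \<subseteq> (fboundaries 1 ?Z' :: (_, 'f) fchain set)"
  proof clarify
    fix z :: "(_, 'f) fchain"
    assume z: "z \<in> fcycles 1 ?Z'" "z \<in> fboundaries 1 ?Z"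
    have "fchain_map 1 \<rho> z = z"
      by (rule fchain_map_eq_self[of _ _ ?Z']) (use z \<rho>(2) in \<open>auto simp: fcycles_def\<close>)
    then show "z \<in> fboundaries 1 ?Z'" using fchain_map_in_fboundaries[OF z(2) \<rho>(1)] by simp
  qed
  obtain B' B where B: "B' \<subseteq> B" "fchain_vs.independent B"
    and cyc: "B' \<subseteq> fcycles 1 ?Z'" "B \<subseteq> (fcycles 1 ?Z :: (_, 'f) fchain set)"
    and B'0: "fchain_vs.span B' \<inter> fboundaries 1 ?Z' \<subseteq> {0}"
    and B': "\<forall>z\<in>fcycles 1 ?Z'. \<exists>w\<in>fchain_vs.span B'. z - w \<in> fboundaries 1 ?Z'"
    and B0: "fchain_vs.span B \<inter> fboundaries 1 ?Z \<subseteq> {0}"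
    and BB: "\<forall>z\<in>fcycles 1 ?Z. \<exists>w\<in>fchain_vs.span B. z - w \<in> fboundaries 1 ?Z"
    by (rule fchain_vs.adapted_complement_bases[OF subspace_fcycles subspace_fboundaries
        fboundaries_subset_fcycles_1 subspace_fcycles subspace_fboundaries fboundaries_subset_fcycles_1
        fcycles_mono[OF sub] reflect])
  \<comment> \<open>Cycles from the smaller graph exist at all scales with \<open>r \<le> 1\<close>;
    the additional ones use the first edge and appear once it is at least as long as
    \<open>r\<close>.\<close>
  define I where "I b = (if b \<in> B' then {p \<in> scale_poset. fst p \<le> 1}
    else {p \<in> scale_poset. fst p \<le> 1 \<and> fst p \<le> snd p})" for b
  \<comment> \<open>The inclusion of \<open>Z\<close> induces an isomorphism, so cycles representing
    a basis for \<open>Z\<close> represent one for every \<open>S\<close> that deforms onto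
    \<open>Z\<close>, without being changed.\<close>
  have lift: "(\<forall>z\<in>fcycles 1 (top_of_set S). \<exists>w\<in>fchain_vs.span C. z - w \<in> fboundaries 1 (top_of_set S)) \<and>
      (\<forall>w\<in>fchain_vs.span C. w \<in> fboundaries 1 (top_of_set S) \<longrightarrow> w = 0)"
    if D: "deformation S Z h" and C: "C \<subseteq> fcycles 1 (top_of_set Z)"
      "fchain_vs.span C \<inter> fboundaries 1 (top_of_set Z) \<subseteq> {0}"
      "\<forall>z\<in>fcycles 1 (top_of_set Z). \<exists>w\<in>fchain_vs.span C. z - w \<in> fboundaries 1 (top_of_set Z)"
    for S Z :: "((nat \<Rightarrow> real) \<times> (nat \<Rightarrow> real)) set" and h and C :: "(_, 'f) fchain set"
  proof (intro conjI ballI impI)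
    interpret D: deformation S Z h by (rule D)
    fix z :: "(_, 'f) fchain"
    assume z: "z \<in> fcycles 1 (top_of_set S)"
    let ?z = "fchain_map 1 (\<lambda>x. h (1, x)) z"
    obtain w where w: "w \<in> fchain_vs.span C" "?z - w \<in> fboundaries 1 (top_of_set Z)"
      using C(3) D.fcycle_homologous(1)[OF z] by blast
    have "(z - ?z) + (?z - w) \<in> fboundaries 1 (top_of_set S)"
      using D.fcycle_homologous(2)[OF z] fboundaries_mono[OF D.subset] w(2)
      by (intro fboundaries_closed(2)) auto
    then show "\<exists>w\<in>fchain_vs.span C. z - w \<in> fboundaries 1 (top_of_set S)"
      using w(1) by auto
  next
    interpret D: deformation S Z h by (rule D)
    fix w :: "(_, 'f) fchain"
    assume w: "w \<in> fchain_vs.span C" "w \<in> fboundaries 1 (top_of_set S)"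
    have "fchain_vs.span C \<subseteq> fcycles 1 (top_of_set Z)"
      by (rule fchain_vs.span_minimal[OF C(1) subspace_fcycles])
    then have "w \<in> fchains 1 (top_of_set Z)" using w(1) by (auto simp: fcycles_def)
    then have "w \<in> fboundaries 1 (top_of_set Z)" using D.fboundaries_reflect w(2) by blast
    then show "w = 0" using C(2) w(1) by blast
  qed
  have adapted: "{b \<in> B. p \<in> I b} \<subseteq> fcycles 1 (top_of_set (?S p)) \<and>
      (\<forall>z\<in>fcycles 1 (top_of_set (?S p)). \<exists>w\<in>fchain_vs.span {b \<in> B. p \<in> I b}.
          z - w \<in> fboundaries 1 (top_of_set (?S p))) \<and>
      (\<forall>w\<in>fchain_vs.span {b \<in> B. p \<in> I b}. w \<in> fboundaries 1 (top_of_set (?S p)) \<longrightarrow> w = 0)"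
    if p: "p \<in> scale_poset" for p
  proof -
    have pos: "0 < fst p" "0 < snd p" using p by (auto simp: scale_poset_def)
    consider (far) "1 < fst p" | (all) "fst p \<le> 1" "fst p \<le> snd p" | (short) "snd p < fst p" "fst p \<le> 1"
      by linarith
    then show ?thesis
    proof cases
      case far
      \<comment> \<open>No interval reaches beyond \<open>r = 1\<close>, so all cycles have to bound
        here, which is what \<open>star_conf_far\<close> provides.\<close>
      then have none: "{b \<in> B. p \<in> I b} = {}" by (auto simp: I_def)
      have "fcycles 1 (top_of_set (?S p)) \<subseteq> (fboundaries 1 (top_of_set (?S p)) :: (_, 'f) fchain set)"
        by (rule star_conf_far[OF far pos(2)]) (use assms in simp)
      then show ?thesis unfolding none by auto
    next
      case all
      note D = deformation_star_conf_all[OF pos(1) all, of k]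
      have "{b \<in> B. p \<in> I b} = B" using p all by (auto simp: I_def)
      moreover have "B \<subseteq> fcycles 1 (top_of_set (?S p))"
        using cyc(2) fcycles_mono[OF deformation.subset[OF D]] by blast
      ultimately show ?thesis using lift[OF D cyc(2) B0 BB] by simp
    next
      case short
      have D: "deformation (?S p) (star_skeleton k {2..k}) (straight id (project {2..k}))"
        by (rule deformation_star_conf_short[OF pos(2) short]) (use assms in simp)
      have "{b \<in> B. p \<in> I b} = B'" using p short B(1) by (auto simp: I_def)
      moreover have "B' \<subseteq> fcycles 1 (top_of_set (?S p))"
        using cyc(1) fcycles_mono[OF deformation.subset[OF D]] by blast
      ultimately show ?thesis using lift[OF D cyc(1) B'0 B'] by simp
    qed
  qed
  have up: "q \<in> I b" if "p \<in> I b" "q \<in> scale_poset" "scale_le p q" for b p q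
    using that by (auto simp: I_def scale_le_def split: if_splits)
  show ?thesis
    unfolding star_PH_eq_filtration_PH
  proof (rule interval_decomposable_of_adapted_basis[where B = B and I = I])
    show "?S p \<subseteq> ?S q" if "p \<in> scale_poset" "q \<in> scale_poset" "scale_le p q" for p q
      using that by (intro star_conf_mono) (auto simp: scale_poset_def scale_le_def)
    show "fchain_vs.independent B" by (rule B(2))
    show "poset_interval scale_poset scale_le (I b)" for b
    proof (rule poset_interval_scale)
      have "(1, 1) \<in> I b" by (auto simp: I_def scale_poset_def)
      then show "I b \<noteq> {}" by blast
      show "I b \<subseteq> scale_poset" by (auto simp: I_def)
    qed (rule up)
    show "q \<in> I b" if "p \<in> I b" "q \<in> scale_poset" "scale_le p q" for b p q
      using that by (rule up)
    show "b \<in> fcycles 1 (top_of_set (?S p))" if "b \<in> B" "p \<in> I b" for b p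
    proof -
      have "p \<in> scale_poset" using that(2) by (auto simp: I_def split: if_splits)
      then show ?thesis using adapted that by blast
    qed
    show "\<exists>w\<in>fchain_vs.span {b \<in> B. p \<in> I b}. z - w \<in> fboundaries 1 (top_of_set (?S p))"
      if "p \<in> scale_poset" "z \<in> fcycles 1 (top_of_set (?S p))" for p z
      using adapted[OF that(1)] that(2) by blast
    show "w = 0" if "p \<in> scale_poset" "w \<in> fchain_vs.span {b \<in> B. p \<in> I b}"
      "w \<in> fboundaries 1 (top_of_set (?S p))" for p w
      using adapted[OF that(1)] that(2,3) by blast
  qed
qed

end
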